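(* Let $n\ge3$, let $(\Omega,\mu,W)$ be any pure graphon, and let $(\omega_1,\dots,\omega_n,A)$ be generated by the $W$-random graph model on $n$ nodes with parameter $(\Omega,\mu,W)$. Let $$b_{sup}=\Big(6\sup_{i\in[n]}r_W(\omega_i,\omega_{m(i)})+36\sqrt{\tfrac{\log n}{n}}\Big)^{1/2},\qquad s_\omega=\sup_{\omega\in\Omega}\ \inf_{i\in[n]}r_W(\omega,\omega_i).$$ Then, with probability at least $1-\frac2n$ under $\mathbb{P}_{(\Omega,\mu,W)}$, $$\forall\epsilon>b_{sup}+s_\omega,\qquad N^{(c)}_\Omega(\epsilon+b_{sup}+s_\omega)\le\widehat N^{(c)}_\Omega(\epsilon)\le N^{(c)}_\Omega(\epsilon-b_{sup}-s_\omega).$$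
   Context: A graphon is a triplet $(\Omega,\mu,W)$ where $\Omega$ is a measurable space, $\mu$ a probability measure on $\Omega$ and $W:\Omega\times\Omega\to[0,1]$ a symmetric measurable function. Neighborhood distance: $r_W(\omega,\omega')=\big(\int_\Omega |W(\omega,z)-W(\omega',z)|^2\mu(dz)\big)^{1/2}$. A graphon is pure if $(\Omega,r_W)$ is a complete separable metric space and $\mu$ has full support (every ball of non-zero radius has positive measure). $N^{(c)}_\Omega(\epsilon)$ is the minimal number of closed $r_W$-balls of radius $\epsilon$ with centers in $\Omega$ needed to cover $\Omega$ (possibly $+\infty$). $W$-random graph model on $n$ nodes: $\omega_1,\dots,\omega_n$ are i.i.d. with law $\mu$ (unobserved); conditionally on them, the entries $A_{ij}$, $i<j$, are independent Bernoulli with parameters $W(\omega_i,\omega_j)$; $A_{ji}=A_{ij}$, $A_{ii}=0$. $\mathbb{P}_{(\Omega,\mu,W)}$ denotes the corresponding probability. For each $i$, $m(i)\in\operatorname{argmin}_{t\ne i}r_W(\omega_i,\omega_t)$. Estimators: with $A_i$ the $i$-th row of $A$ and $\langle A_i,A_j\rangle_n=\frac1n\sum_{k=1}^n A_{ik}A_{jk}$, put $\widehat f(i,j)=\max_{k\ne i,j}|\langle A_k,A_i-A_j\rangle_n|$, $\widehat m(i)\in\operatorname{argmin}_{j\ne i}\widehat f(i,j)$ (ties broken arbitrarily), and $\widehat r^{\,2}(i,j)=\langle A_i,A_{\widehat m(i)}\rangle_n+\langle A_j,A_{\widehat m(j)}\rangle_n-2\langle A_i,A_j\rangle_n$; $\widehat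 r(i,j)$ is the square root of the positive part of $\widehat r^{\,2}(i,j)$. $\widehat N^{(c)}_\Omega(\epsilon)$ is the covering number of $\{1,\dots,n\}$ with respect to $\widehat r$: the minimal size of a set $S\subset[n]$ such that every $j\in[n]$ has some $i\in S$ with $\widehat r(i,j)\le\epsilon$. *)

theory Defs
  imports "HOL-Probability.Probability"
begin

section \<open>Graphons\<close>

locale graphon = prob_space M for M :: "'a measure" +
  fixes W :: "'a \<Rightarrow> 'a \<Rightarrow> real"
  assumes W_measurable: "(\<lambda>(x, y). W x y) \<in> borel_measurable (M \<Otimes>\<^sub>M M)"
    and W_range: "\<And>x y. x \<in> space M \<Longrightarrow> y \<in> space M \<Longrightarrow> 0 \<le> W x y \<and> W x y \<le> 1"
    and W_sym: "\<And>x y. x \<in> space M \<Longrightarrow> y \<in> space M \<Longrightarrow> W x y = W y x"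

definition nbhd_dist :: "'a measure \<Rightarrow> ('a \<Rightarrow> 'a \<Rightarrow> real) \<Rightarrow> 'a \<Rightarrow> 'a \<Rightarrow> real" where
  "nbhd_dist M W x y = sqrt (\<integral>z. \<bar>W x z - W y z\<bar>\<^sup>2 \<partial>M)"

locale pure_graphon = graphon M W for M :: "'a measure" and W +
  assumes metric: "Metric_space (space M) (nbhd_dist M W)"
    and complete: "Metric_space.mcomplete (space M) (nbhd_dist M W)"
    and separable: "separable_space (Metric_space.mtopology (space M) (nbhd_dist M W))"
    and full_support:
      "\<And>x r. x \<in> space M \<Longrightarrow> r > 0 \<Longrightarrow>
         measure M (Metric_space.mball (space M) (nbhd_dist M W) x r) > 0"

text \<open>
  The least number of closed \<open>d\<close>-balls of radius \<open>\<epsilon>\<close> with centres in \<open>X\<close> that cover \<open>X\<close>; its value is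
  \<open>\<infinity>\<close>, the infimum of the empty set, if no finite cover exists. The function \<open>d\<close> need not be a
  metric, since this is also used for the estimated distance on \<open>{1..n}\<close>.
\<close>

definition covering_number :: "'a set \<Rightarrow> ('a \<Rightarrow> 'a \<Rightarrow> real) \<Rightarrow> real \<Rightarrow> enat" where
  "covering_number X d \<epsilon> =
     Inf {enat (card S) | S. finite S \<and> S \<subseteq> X \<and> (\<forall>x\<in>X. \<exists>c\<in>S. d c x \<le> \<epsilon>)}"

section \<open>The random graph model\<close>

text \<open>
  Nodes are \<open>1, \<dots>, n\<close>. On the sample space \<open>P\<close>, \<open>\<omega> x i\<close> is the latent position of node \<open>i\<close> and
  \<open>A x\<close> is the adjacency matrix.
\<close>

definition node_pairs :: "nat \<Rightarrow> (nat \<times> nat) set" where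
  "node_pairs n = {(i, j). 1 \<le> i \<and> i < j \<and> j \<le> n}"

definition latent_algebra ::
    "'s measure \<Rightarrow> nat \<Rightarrow> 'a measure \<Rightarrow> ('s \<Rightarrow> nat \<Rightarrow> 'a) \<Rightarrow> 's measure" where
  "latent_algebra P n M \<omega> =
     vimage_algebra (space P) (\<lambda>x. restrict (\<omega> x) {1..n}) (PiM {1..n} (\<lambda>_. M))"

text \<open>
  Assumption \<open>edges\<close> says that, given the latent positions, the entries above the diagonal are
  independent Bernoulli variables: the conditional probability of every configuration \<open>e\<close> of these
  entries is the product of the Bernoulli point masses.
\<close>

locale W_random_graph = prob_space P for P :: "'s measure" +
  fixes n :: nat and M :: "'a measure" and W :: "'a \<Rightarrow> 'a \<Rightarrow> real"
    and \<omega> :: "'s \<Rightarrow> nat \<Rightarrow> 'a" and A :: "'s \<Rightarrow> nat \<Rightarrow> nat \<Rightarrow> real"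
  assumes latent_indep: "indep_vars (\<lambda>_. M) (\<lambda>i x. \<omega> x i) {1..n}"
    and latent_law: "\<And>i. i \<in> {1..n} \<Longrightarrow> distr P M (\<lambda>x. \<omega> x i) = M"
    and A_measurable:
      "\<And>i j. i \<in> {1..n} \<Longrightarrow> j \<in> {1..n} \<Longrightarrow> (\<lambda>x. A x i j) \<in> borel_measurable P"
    and A_01: "\<And>x i j. x \<in> space P \<Longrightarrow> i \<in> {1..n} \<Longrightarrow> j \<in> {1..n} \<Longrightarrow> A x i j \<in> {0, 1}"
    and A_sym: "\<And>x i j. x \<in> space P \<Longrightarrow> i \<in> {1..n} \<Longrightarrow> j \<in> {1..n} \<Longrightarrow> A x j i = A x i j"
    and A_diag: "\<And>x i. x \<in> space P \<Longrightarrow> i \<in> {1..n} \<Longrightarrow> A x i i = 0"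
    and edges: "\<And>e :: nat \<times> nat \<Rightarrow> bool. AE x in P.
      real_cond_exp P (latent_algebra P n M \<omega>)
        (indicator {y \<in> space P. \<forall>(i, j)\<in>node_pairs n. A y i j = of_bool (e (i, j))}) x =
      (\<Prod>(i, j)\<in>node_pairs n. pmf (bernoulli_pmf (W (\<omega> x i) (\<omega> x j))) (e (i, j)))"

section \<open>Estimators\<close>

definition row_inner :: "nat \<Rightarrow> (nat \<Rightarrow> real) \<Rightarrow> (nat \<Rightarrow> real) \<Rightarrow> real" where
  "row_inner n u v = (1 / real n) * (\<Sum>k=1..n. u k * v k)"

definition f_hat :: "nat \<Rightarrow> (nat \<Rightarrow> nat \<Rightarrow> real) \<Rightarrow> nat \<Rightarrow> nat \<Rightarrow> real" where
  "f_hat n a i j = Max ((\<lambda>k. \<bar>row_inner n (a k) (\<lambda>l. a i l - a j l)\<bar>) ` ({1..n} - {i, j}))"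

definition other_argmin :: "nat \<Rightarrow> (nat \<Rightarrow> nat \<Rightarrow> real) \<Rightarrow> (nat \<Rightarrow> nat) \<Rightarrow> bool" where
  "other_argmin n g m \<longleftrightarrow> (\<forall>i\<in>{1..n}. is_arg_min (g i) (\<lambda>j. j \<in> {1..n} \<and> j \<noteq> i) (m i))"

definition r_hat_sq ::
    "nat \<Rightarrow> (nat \<Rightarrow> nat \<Rightarrow> real) \<Rightarrow> (nat \<Rightarrow> nat) \<Rightarrow> nat \<Rightarrow> nat \<Rightarrow> real" where
  "r_hat_sq n a mhat i j =
     row_inner n (a i) (a (mhat i)) + row_inner n (a j) (a (mhat j)) - 2 * row_inner n (a i) (a j)"

definition r_hat :: "nat \<Rightarrow> (nat \<Rightarrow> nat \<Rightarrow> real) \<Rightarrow> (nat \<Rightarrow> nat) \<Rightarrow> nat \<Rightarrow> nat \<Rightarrow> real" where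
  "r_hat n a mhat i j = sqrt (max 0 (r_hat_sq n a mhat i j))"

section \<open>Error terms\<close>

definition b_sup ::
    "nat \<Rightarrow> 'a measure \<Rightarrow> ('a \<Rightarrow> 'a \<Rightarrow> real) \<Rightarrow> (nat \<Rightarrow> 'a) \<Rightarrow> (nat \<Rightarrow> nat) \<Rightarrow> real" where
  "b_sup n M W w m =
     sqrt (6 * (SUP i\<in>{1..n}. nbhd_dist M W (w i) (w (m i))) + 36 * sqrt (ln (real n) / real n))"

definition s_sup :: "nat \<Rightarrow> 'a measure \<Rightarrow> ('a \<Rightarrow> 'a \<Rightarrow> real) \<Rightarrow> (nat \<Rightarrow> 'a) \<Rightarrow> real" where
  "s_sup n M W w = (SUP z\<in>space M. INF i\<in>{1..n}. nbhd_dist M W z (w i))"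

end

theory Submission
  imports Defs
begin

text \<open>
  Write \<open>\<langle>x, y\<rangle>\<close> for the \<open>L\<^sup>2\<close> inner product of the sections of \<open>W\<close> at \<open>x\<close> and \<open>y\<close>. For \<open>i \<noteq> j\<close> the number of common
  neighbours of \<open>i\<close> and \<open>j\<close> is, given \<open>\<omega>\<^sub>i\<close> and \<open>\<omega>\<^sub>j\<close>, binomial with parameters \<open>n - 2\<close> and \<open>\<langle>\<omega>\<^sub>i, \<omega>\<^sub>j\<rangle>\<close>, so by
  Hoeffding and a union bound all off-diagonal \<open>\<langle>A\<^sub>i, A\<^sub>j\<rangle>\<^sub>n\<close> are within \<open>\<delta> = 3 sqrt (ln n / n)\<close> of
  \<open>\<langle>\<omega>\<^sub>i, \<omega>\<^sub>j\<rangle>\<close> with probability at least \<open>1 - 2 / n\<close>. The diagonal products are not observable; comparing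
  the minimizer of \<open>f_hat\<close> with the true nearest neighbour shows that \<open>\<langle>A\<^sub>i, A\<^bsub>mhat i\<^esub>\<rangle>\<^sub>n\<close> estimates
  \<open>\<langle>\<omega>\<^sub>i, \<omega>\<^sub>i\<rangle>\<close> up to \<open>2 R + 5 \<delta>\<close>, where \<open>R\<close> is the largest nearest-neighbour distance. Hence \<open>r_hat\<close> and
  the neighbourhood distance differ by at most \<open>sqrt (6 R + 12 \<delta>) = b_sup\<close>, and covers of the nodes
  and of the graphon can be transferred at the additional cost \<open>s_sup\<close>.
\<close>

section \<open>Covering numbers\<close>

text \<open>The image of a finite cover has no more elements than the cover itself, and
  \<open>f\<close> may depend on the cover. If no finite cover of \<open>X\<close> exists, the right
  side is \<infinity>.\<close>

lemma covering_number_le_of_map: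
  assumes "\<And>S. finite S \<Longrightarrow> S \<subseteq> X \<Longrightarrow> (\<forall>x\<in>X. \<exists>c\<in>S. d c x \<le> \<epsilon>) \<Longrightarrow>
      \<exists>f. f ` S \<subseteq> Y \<and> (\<forall>y\<in>Y. \<exists>c\<in>S. d' (f c) y \<le> \<epsilon>')"
  shows "covering_number Y d' \<epsilon>' \<le> covering_number X d \<epsilon>"
  unfolding covering_number_def
proof (rule Inf_greatest, safe)
  fix S assume S: "finite S" "S \<subseteq> X" "\<forall>x\<in>X. \<exists>c\<in>S. d c x \<le> \<epsilon>"
  then obtain f where f: "f ` S \<subseteq> Y" "\<forall>y\<in>Y. \<exists>c\<in>S. d' (f c) y \<le> \<epsilon>'"
    using assms by blast
  have "Inf {enat (card S) |S. finite S \<and> S \<subseteq> Y \<and> (\<forall>x\<in>Y. \<exists>c\<in>S. d' c x \<le> \<epsilon>')} \<le> enat (card (f ` S))"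
    using f S(1) by (intro Inf_lower) auto
  also have "\<dots> \<le> enat (card S)"
    using S(1) by (simp add: card_image_le)
  finally show "Inf {enat (card S) |S. finite S \<and> S \<subseteq> Y \<and> (\<forall>x\<in>Y. \<exists>c\<in>S. d' c x \<le> \<epsilon>')} \<le> enat (card S)" .
qed

lemma covering_number_antimono:
  assumes "\<epsilon> \<le> \<epsilon>'"
  shows "covering_number X d \<epsilon>' \<le> covering_number X d \<epsilon>"
  by (rule covering_number_le_of_map, rule exI[of _ "\<lambda>x. x"]) (use assms order_trans in auto, blast)

lemma covering_number_cong:
  assumes "\<And>x y. x \<in> X \<Longrightarrow> y \<in> X \<Longrightarrow> d x y = d' x y"
  shows "covering_number X d \<epsilon> = covering_number X d' \<epsilon>"
proof -
  have "covering_number X e \<epsilon> \<le> covering_number X e' \<epsilon>"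
    if "\<And>x y. x \<in> X \<Longrightarrow> y \<in> X \<Longrightarrow> e x y = e' x y" for e e'
    by (rule covering_number_le_of_map, rule exI[of _ "\<lambda>x. x"]) (use that in \<open>auto, metis subsetD\<close>)
  then show ?thesis
    using assms by (intro antisym) auto
qed

text \<open>Centres are transported both ways: a node goes to its position \<open>w i\<close>, and a
  point of \<open>M\<close> goes to a node within \<open>s\<close>. Each transport costs one
  \<open>b\<close> for exchanging the two distances and one \<open>s\<close> for the detour. The
  triangle inequality is applied to \<open>d\<close> only.\<close>

lemma (in Metric_space) covering_number_approx:
  assumes w: "w \<in> I \<rightarrow> M"
    and approx: "\<And>i j. i \<in> I \<Longrightarrow> j \<in> I \<Longrightarrow> \<bar>d' i j - d (w i) (w j)\<bar> \<le> b"
    and dense: "\<And>x. x \<in> M \<Longrightarrow> \<exists>i\<in>I. d x (w i) \<le> s"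
  shows "covering_number M d (\<epsilon> + b + s) \<le> covering_number I d' \<epsilon>"
    and "covering_number I d' \<epsilon> \<le> covering_number M d (\<epsilon> - b - s)"
proof -
  show "covering_number M d (\<epsilon> + b + s) \<le> covering_number I d' \<epsilon>"
  proof (rule covering_number_le_of_map, intro exI conjI ballI)
    fix S assume S: "finite S" "S \<subseteq> I" "\<forall>x\<in>I. \<exists>c\<in>S. d' c x \<le> \<epsilon>"
    show "w ` S \<subseteq> M" using S w by auto
    fix x assume x: "x \<in> M"
    then obtain j where j: "j \<in> I" "d x (w j) \<le> s" using dense by blast
    then obtain i where i: "i \<in> S" "d' i j \<le> \<epsilon>" using S by blast
    have "d (w i) x \<le> d (w i) (w j) + d x (w j)"
      using x i j S w by (metis triangle commute funcset_mem subsetD)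
    moreover have "\<bar>d' i j - d (w i) (w j)\<bar> \<le> b" using approx i j S by blast
    ultimately show "\<exists>c\<in>S. d (w c) x \<le> \<epsilon> + b + s" using i j by (intro bexI[of _ i]) auto
  qed
  show "covering_number I d' \<epsilon> \<le> covering_number M d (\<epsilon> - b - s)"
  proof (rule covering_number_le_of_map)
    fix S assume S: "finite S" "S \<subseteq> M" "\<forall>x\<in>M. \<exists>c\<in>S. d c x \<le> \<epsilon> - b - s"
    obtain f where f: "\<And>x. x \<in> M \<Longrightarrow> f x \<in> I \<and> d x (w (f x)) \<le> s"
      using dense by metis
    show "\<exists>f. f ` S \<subseteq> I \<and> (\<forall>y\<in>I. \<exists>c\<in>S. d' (f c) y \<le> \<epsilon>)"
    proof (intro exI conjI ballI)
      show "f ` S \<subseteq> I" using f S by auto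
      fix j assume j: "j \<in> I"
      then have wj: "w j \<in> M" using w by auto
      then obtain c where c: "c \<in> S" "d c (w j) \<le> \<epsilon> - b - s" using S by blast
      then have fc: "f c \<in> I" "d c (w (f c)) \<le> s" "c \<in> M" using f S by auto
      then have "w (f c) \<in> M" using w by auto
      then have "d (w (f c)) (w j) \<le> d c (w (f c)) + d c (w j)"
        using fc wj by (metis triangle commute)
      moreover have "\<bar>d' (f c) j - d (w (f c)) (w j)\<bar> \<le> b" using approx fc j by blast
      ultimately show "\<exists>c\<in>S. d' (f c) j \<le> \<epsilon>" using c fc by (intro bexI[of _ c]) auto
    qed
  qed
qed

section \<open>The estimated distance\<close>

text \<open>As \<open>g\<close> is bounded by 1, the left side is at most the integral of
  \<open>\<bar>f x\<bar>\<close>. On a probability space this is at most the L2 norm, because the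
  variance of \<open>\<bar>f x\<bar>\<close> is nonnegative.\<close>

lemma (in prob_space) abs_integral_mult_le_L2:
  fixes f g :: "'a \<Rightarrow> real"
  assumes [measurable]: "f \<in> borel_measurable M" "g \<in> borel_measurable M"
    and f: "\<And>x. x \<in> space M \<Longrightarrow> \<bar>f x\<bar> \<le> 1" and g: "\<And>x. x \<in> space M \<Longrightarrow> \<bar>g x\<bar> \<le> 1"
  shows "\<bar>\<integral>x. f x * g x \<partial>M\<bar> \<le> sqrt (\<integral>x. \<bar>f x\<bar>\<^sup>2 \<partial>M)"
proof -
  have int: "integrable M (\<lambda>x. \<bar>f x\<bar>)" "integrable M (\<lambda>x. \<bar>f x\<bar>\<^sup>2)" "integrable M (\<lambda>x. f x * g x)"
    using f g by (auto intro!: integrable_const_bound[where B=1] AE_I2 simp: abs_mult mult_le_one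
        abs_square_le_1)
  have "\<bar>\<integral>x. f x * g x \<partial>M\<bar> \<le> (\<integral>x. \<bar>f x * g x\<bar> \<partial>M)"
    by (rule integral_abs_bound)
  also have "\<dots> \<le> (\<integral>x. \<bar>f x\<bar> \<partial>M)"
    using int(1) integrable_abs[OF int(3)] g by (intro integral_mono) (auto simp: abs_mult mult_left_le)
  also have "\<dots> \<le> sqrt (\<integral>x. \<bar>f x\<bar>\<^sup>2 \<partial>M)"
    using variance_positive[of "\<lambda>x. \<bar>f x\<bar>"] variance_eq[OF int(1,2)]
    by (intro real_le_rsqrt) linarith
  finally show ?thesis .
qed

text \<open>By subadditivity of the square root. It turns an error bound for squared distances into
  one for distances, whence the outer root in \<open>b_sup\<close>.\<close>

lemma abs_sqrt_diff_le:
  fixes x y :: real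
  assumes "0 \<le> x" "0 \<le> y"
  shows "\<bar>sqrt x - sqrt y\<bar> \<le> sqrt \<bar>x - y\<bar>"
proof -
  have *: "sqrt u \<le> sqrt \<bar>u - v\<bar> + sqrt v" if "0 \<le> u" "0 \<le> v" for u v :: real
  proof -
    have "sqrt u \<le> sqrt (\<bar>u - v\<bar> + v)" by simp
    also have "\<dots> \<le> sqrt \<bar>u - v\<bar> + sqrt v" using that by (intro sqrt_add_le_add_sqrt) auto
    finally show ?thesis .
  qed
  show ?thesis using *[of x y] *[of y x] assms by (simp add: abs_minus_commute)
qed

lemma row_inner_diff: "row_inner n u (\<lambda>l. v l - v' l) = row_inner n u v - row_inner n u v'"
  by (simp add: row_inner_def sum_subtractf algebra_simps)

section \<open>Inner products of graphon sections\<close>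

context graphon begin

definition nbhd_inner :: "'a \<Rightarrow> 'a \<Rightarrow> real" where
  "nbhd_inner x y = (\<integral>z. W x z * W y z \<partial>M)"

lemma W_section_measurable: "x \<in> space M \<Longrightarrow> W x \<in> borel_measurable M"
  using measurable_Pair2[OF W_measurable] by simp

lemma W_mult_integrable:
  assumes "x \<in> space M" "y \<in> space M"
  shows "integrable M (\<lambda>z. W x z * W y z)"
  using W_range assms W_section_measurable
  by (intro integrable_const_bound[where B=1] AE_I2) (auto simp: abs_mult intro!: mult_le_one)

lemma nbhd_inner_bounds:
  assumes "x \<in> space M" "y \<in> space M"
  shows "0 \<le> nbhd_inner x y" "nbhd_inner x y \<le> 1"
proof -
  show "0 \<le> nbhd_inner x y"
    unfolding nbhd_inner_def using W_range assms by (intro Bochner_Integration.integral_nonneg) auto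
  have "nbhd_inner x y \<le> (\<integral>z. 1 \<partial>M)"
    unfolding nbhd_inner_def using W_range assms
    by (intro integral_mono W_mult_integrable) (auto intro!: mult_le_one)
  then show "nbhd_inner x y \<le> 1" by (simp add: prob_space)
qed

lemma nbhd_dist_nonneg: "0 \<le> nbhd_dist M W x y"
  by (simp add: nbhd_dist_def)

text \<open>Expanding the square reduces the estimation of distances to that of inner products;
  \<open>r_hat_sq\<close> is the empirical counterpart of the right side.\<close>

lemma nbhd_dist_sq:
  assumes "x \<in> space M" "y \<in> space M"
  shows "(nbhd_dist M W x y)\<^sup>2 = nbhd_inner x x + nbhd_inner y y - 2 * nbhd_inner x y"
proof -
  have "(nbhd_dist M W x y)\<^sup>2 = (\<integral>z. \<bar>W x z - W y z\<bar>\<^sup>2 \<partial>M)"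
    by (simp add: nbhd_dist_def)
  also have "\<dots> = (\<integral>z. W x z * W x z + W y z * W y z - 2 * (W x z * W y z) \<partial>M)"
    by (intro Bochner_Integration.integral_cong) (auto simp: power2_eq_square algebra_simps)
  also have "\<dots> = nbhd_inner x x + nbhd_inner y y - 2 * nbhd_inner x y"
    by (simp add: nbhd_inner_def W_mult_integrable assms)
  finally show ?thesis .
qed

lemma nbhd_dist_le_1:
  assumes "x \<in> space M" "y \<in> space M"
  shows "nbhd_dist M W x y \<le> 1"
proof -
  have "(\<integral>z. \<bar>W x z - W y z\<bar>\<^sup>2 \<partial>M) \<le> (\<integral>z. 1 \<partial>M)"
  proof (rule integral_mono')
    fix z assume "z \<in> space M"
    then show "\<bar>W x z - W y z\<bar>\<^sup>2 \<le> 1"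
      using W_range[of x z] W_range[of y z] assms by (auto simp: abs_square_le_1)
  qed auto
  then show ?thesis by (simp add: nbhd_dist_def prob_space)
qed

lemma W_diff_mult_integral_le:
  assumes [simp]: "x \<in> space M" "y \<in> space M" and g: "g \<in> borel_measurable M"
    and "\<And>z. z \<in> space M \<Longrightarrow> \<bar>g z\<bar> \<le> 1"
  shows "\<bar>\<integral>z. (W x z - W y z) * g z \<partial>M\<bar> \<le> nbhd_dist M W x y"
  unfolding nbhd_dist_def
proof (rule abs_integral_mult_le_L2)
  fix z assume "z \<in> space M"
  then show "\<bar>W x z - W y z\<bar> \<le> 1"
    using W_range[of x z] W_range[of y z] by auto
qed (use assms W_section_measurable in auto)

lemma nbhd_inner_diff_le:
  assumes [simp]: "x \<in> space M" "y \<in> space M" "u \<in> space M"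
  shows "\<bar>nbhd_inner u x - nbhd_inner u y\<bar> \<le> nbhd_dist M W x y"
proof -
  have "nbhd_inner u x - nbhd_inner u y = (\<integral>z. (W x z - W y z) * W u z \<partial>M)"
    by (simp add: nbhd_inner_def W_mult_integrable left_diff_distrib mult.commute[of "W u _"])
  then show ?thesis
    using W_diff_mult_integral_le[of x y "W u"] W_range[of u] W_section_measurable[of u]
    by (simp add: abs_le_iff order_trans[of _ 0 1])
qed

text \<open>The quantity is the inner product of \<open>W x - W y\<close> with
  \<open>W u - W v\<close>, and the latter is bounded by 1. The distance is therefore paid once; two
  applications of \<open>nbhd_inner_diff_le\<close> would cost it twice.\<close>

lemma nbhd_inner_diff_diff_le:
  assumes [simp]: "x \<in> space M" "y \<in> space M" "u \<in> space M" "v \<in> space M"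
  shows "\<bar>(nbhd_inner x u - nbhd_inner x v) - (nbhd_inner y u - nbhd_inner y v)\<bar> \<le> nbhd_dist M W x y"
proof -
  have "(nbhd_inner x u - nbhd_inner x v) - (nbhd_inner y u - nbhd_inner y v) =
      (\<integral>z. W x z * W u z - W x z * W v z - (W y z * W u z - W y z * W v z) \<partial>M)"
    by (simp add: nbhd_inner_def W_mult_integrable)
  also have "\<dots> = (\<integral>z. (W x z - W y z) * (W u z - W v z) \<partial>M)"
    by (intro Bochner_Integration.integral_cong) (auto simp: algebra_simps)
  also have "\<bar>\<dots>\<bar> \<le> nbhd_dist M W x y"
  proof (rule W_diff_mult_integral_le)
    fix z assume "z \<in> space M"
    then show "\<bar>W u z - W v z\<bar> \<le> 1"
      using W_range[of u z] W_range[of v z] by auto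
  qed (use W_section_measurable in auto)
  finally show ?thesis .
qed

end

lemma other_argminD:
  assumes "other_argmin n g m" "i \<in> {1..n}"
  shows "m i \<in> {1..n}" "m i \<noteq> i" "\<And>j. j \<in> {1..n} \<Longrightarrow> j \<noteq> i \<Longrightarrow> g i (m i) \<le> g i j"
  using assms by (auto simp: other_argmin_def is_arg_min_def not_less)

lemma f_hat_ge:
  assumes "k \<in> {1..n} - {i, j}"
  shows "\<bar>row_inner n (a k) (a i) - row_inner n (a k) (a j)\<bar> \<le> f_hat n a i j"
  unfolding f_hat_def row_inner_diff using assms by (intro Max_ge) auto

lemma f_hat_le:
  assumes "n \<ge> 3"
    and "\<And>k. k \<in> {1..n} - {i, j} \<Longrightarrow> \<bar>row_inner n (a k) (a i) - row_inner n (a k) (a j)\<bar> \<le> c"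
  shows "f_hat n a i j \<le> c"
proof -
  \<comment> \<open>With three nodes the maximum in \<open>f_hat\<close> ranges over a nonempty set,
    so \<open>Max\<close> is meaningful.\<close>
  have "card {i, j} < card {1..n}"
    using assms(1) by (intro le_less_trans[OF card_insert_le_m1[of 2]]) auto
  then have "{1..n} - {i, j} \<noteq> {}"
    by (metis Diff_eq_empty_iff card_mono finite.emptyI finite.insertI leD)
  then show ?thesis
    unfolding f_hat_def row_inner_diff using assms(2) by (subst Max_le_iff) auto
qed

section \<open>Deterministic comparison of the estimated and the true distance at one sample\<close>

context graphon begin

context
  fixes n :: nat and w :: "nat \<Rightarrow> 'a" and a :: "nat \<Rightarrow> nat \<Rightarrow> real" and m mhat :: "nat \<Rightarrow> nat"
    and \<delta> R :: real
  assumes n: "n \<ge> 3"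
    and w: "\<And>i. i \<in> {1..n} \<Longrightarrow> w i \<in> space M"
    and a01: "\<And>i j. i \<in> {1..n} \<Longrightarrow> j \<in> {1..n} \<Longrightarrow> a i j \<in> {0, 1}"
    and close: "\<And>i j. i \<in> {1..n} \<Longrightarrow> j \<in> {1..n} \<Longrightarrow> i \<noteq> j \<Longrightarrow>
        \<bar>row_inner n (a i) (a j) - nbhd_inner (w i) (w j)\<bar> \<le> \<delta>"
    and m: "\<And>i. i \<in> {1..n} \<Longrightarrow> m i \<in> {1..n} \<and> m i \<noteq> i \<and> nbhd_dist M W (w i) (w (m i)) \<le> R"
    and mhat: "other_argmin n (f_hat n a) mhat"
begin

text \<open>The minimizer \<open>k\<close> does at least as well as the true nearest neighbour,
  whose \<open>f_hat\<close> is small. Replacing \<open>w i\<close> by \<open>w (m i)\<close> in one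
  argument costs \<open>R\<close>, \<open>f_hat\<close> costs \<open>R + 2 * \<delta>\<close>, and
  three passages between empirical and true inner products cost \<open>3 * \<delta>\<close>.\<close>

lemma row_inner_mhat_close:
  assumes i: "i \<in> {1..n}"
  shows "\<bar>row_inner n (a i) (a (mhat i)) - nbhd_inner (w i) (w i)\<bar> \<le> 2 * R + 5 * \<delta>"
proof -
  define k where "k = mhat i"
  have mi: "m i \<in> {1..n}" "m i \<noteq> i" "nbhd_dist M W (w i) (w (m i)) \<le> R" using m[OF i] by auto
  have k: "k \<in> {1..n}" "k \<noteq> i" "f_hat n a i k \<le> f_hat n a i (m i)"
    using other_argminD[OF mhat i] mi by (auto simp: k_def)
  note w' = w[OF i] w[OF k(1)] w[OF mi(1)]
  have "0 \<le> R" using mi(3) nbhd_dist_nonneg[of "w i" "w (m i)"] by linarith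
  have "0 \<le> \<delta>" using close[OF i k(1) k(2)[symmetric]] by linarith
  \<comment> \<open>Every index \<open>l\<close> of the maximum differs from \<open>i\<close> and
    \<open>m i\<close>, so both products are off the diagonal and each costs one
    \<open>\<delta>\<close>.\<close>
  have "f_hat n a i (m i) \<le> R + 2 * \<delta>"
  proof (rule f_hat_le[OF n])
    fix l assume l: "l \<in> {1..n} - {i, m i}"
    have "\<bar>nbhd_inner (w l) (w i) - nbhd_inner (w l) (w (m i))\<bar> \<le> R"
      using nbhd_inner_diff_le[of "w i" "w (m i)" "w l"] w w' mi l by auto
    then show "\<bar>row_inner n (a l) (a i) - row_inner n (a l) (a (m i))\<bar> \<le> R + 2 * \<delta>"
      using close[of l i] close[of l "m i"] l i mi(1) by (simp add: abs_le_iff)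
  qed
  then have fk: "f_hat n a i k \<le> R + 2 * \<delta>" using k by simp
  have "\<bar>nbhd_inner (w i) (w i) - nbhd_inner (w i) (w k)\<bar> \<le> 2 * R + 4 * \<delta>"
  \<comment> \<open>If the minimizer is the true nearest neighbour, \<open>m i\<close> is excluded
    from the maximum, but \<open>R\<close> bounds the difference directly.\<close>
  proof (cases "k = m i")
    case True
    then show ?thesis
      using nbhd_inner_diff_le[of "w i" "w k" "w i"] w' mi \<open>0 \<le> R\<close> \<open>0 \<le> \<delta>\<close> by auto
  next
    case False
    \<comment> \<open>Here \<open>m i\<close> is one of the nodes over which the maximum \<open>f_hat n a i k\<close> is taken.\<close>
    have "\<bar>(nbhd_inner (w i) (w i) - nbhd_inner (w i) (w k)) - (nbhd_inner (w (m i)) (w i) - nbhd_inner (w (m i)) (w k))\<bar> \<le> R"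
      using nbhd_inner_diff_diff_le[of "w i" "w (m i)" "w i" "w k"] w' mi by auto
    moreover have "\<bar>row_inner n (a (m i)) (a i) - row_inner n (a (m i)) (a k)\<bar> \<le> R + 2 * \<delta>"
      using f_hat_ge[of "m i" n i k a] fk mi False by auto
    ultimately show ?thesis
      using close[OF mi(1) i mi(2)] close[OF mi(1) k(1) False[symmetric]] unfolding abs_le_iff by linarith
  qed
  then show ?thesis
    using close[OF i k(1) k(2)[symmetric]] unfolding k_def[symmetric] abs_le_iff by linarith
qed

text \<open>For distinct nodes the two diagonal estimates contribute
  \<open>4 * R + 10 * \<delta>\<close> and the doubled off-diagonal product
  \<open>2 * \<delta>\<close> to the error in the squared distance, which stays below
  \<open>6 * R + 12 * \<delta>\<close>.\<close>

lemma r_hat_close: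
  assumes i: "i \<in> {1..n}" and j: "j \<in> {1..n}"
  shows "\<bar>r_hat n a mhat i j - nbhd_dist M W (w i) (w j)\<bar> \<le> sqrt (6 * R + 12 * \<delta>)"
proof -
  have R: "0 \<le> R" using m[OF i] nbhd_dist_nonneg[of "w i" "w (m i)"] by linarith
  have "m i \<in> {1..n}" "i \<noteq> m i" using m[OF i] by auto
  from close[OF i this] have \<delta>: "0 \<le> \<delta>" by linarith
  show ?thesis
  proof (cases "i = j")
    case True
    \<comment> \<open>On the diagonal \<open>r_hat_sq\<close> may be far below \<open>0\<close>; only its positive part is close to the truth.\<close>
    have "row_inner n (a i) (a (mhat i)) \<le> row_inner n (a i) (a i)"
      unfolding row_inner_def
    proof (rule mult_left_mono, rule sum_mono)
      fix k assume k: "k \<in> {1..n}"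
      \<comment> \<open>For entries in \<open>{0, 1}\<close> the right side equals
        \<open>a i k\<close>.\<close>
      show "a i k * a (mhat i) k \<le> a i k * a i k"
        using a01[OF i k] a01[OF other_argminD(1)[OF mhat i] k] by auto
    qed auto
    then have "r_hat n a mhat i j = 0"
      using True by (simp add: r_hat_def r_hat_sq_def)
    then show ?thesis
      using True R \<delta> by (simp add: nbhd_dist_def)
  next
    case False
    let ?r = "nbhd_dist M W (w i) (w j)"
    have *: "\<bar>r_hat_sq n a mhat i j - ?r\<^sup>2\<bar> \<le> 6 * R + 12 * \<delta>"
      using row_inner_mhat_close[OF i] row_inner_mhat_close[OF j] close[OF i j False] R
      unfolding nbhd_dist_sq[OF w[OF i] w[OF j]] r_hat_sq_def abs_le_iff by linarith
    have "\<bar>r_hat n a mhat i j - sqrt (?r\<^sup>2)\<bar> \<le> sqrt \<bar>max 0 (r_hat_sq n a mhat i j) - ?r\<^sup>2\<bar>"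
      unfolding r_hat_def by (rule abs_sqrt_diff_le) auto
    \<comment> \<open>Taking the positive part does not move a number away from a nonnegative
      target.\<close>
    also have "\<dots> \<le> sqrt \<bar>r_hat_sq n a mhat i j - ?r\<^sup>2\<bar>"
      using zero_le_power2[of ?r] by (auto simp: max_def abs_if)
    also have "\<dots> \<le> sqrt (6 * R + 12 * \<delta>)"
      using * by simp
    finally show ?thesis
      using nbhd_dist_nonneg by simp
  qed
qed

end

end

section \<open>Concentration of common neighbour counts\<close>

text \<open>The left side is the moment generating function of a Bernoulli variable with parameter
  \<open>p\<close>, so this is Hoeffding's lemma. For negative \<open>l\<close>, factoring out
  \<open>exp l\<close> leaves the complementary variable, with parameter \<open>1 - p\<close> and
  argument \<open>- l\<close>.\<close>

lemma Hoeffding_bernoulli: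
  fixes l p :: real
  assumes p: "0 \<le> p" "p \<le> 1"
  shows "1 + p * (exp l - 1) \<le> exp (l * p + l\<^sup>2 / 8)"
proof -
  have *: "1 + q * (exp h - 1) \<le> exp (h * q + h\<^sup>2 / 8)" if "0 \<le> h" "0 \<le> q" for h q :: real
  proof -
    have "0 < 1 + q * (exp h - 1)" using that by (intro add_pos_nonneg mult_nonneg_nonneg) auto
    then have "1 + q * (exp h - 1) = exp (ln (1 + q * (exp h - 1)))" by simp
    also have "\<dots> \<le> exp (h * q + h\<^sup>2 / 8)"
      using Hoeffdings_lemma_aux[OF that] by simp
    finally show ?thesis .
  qed
  show ?thesis
  proof (cases "0 \<le> l")
    case True
    then show ?thesis using * p by simp
  next
    case False
    have "1 + p * (exp l - 1) = exp l * (1 + (1 - p) * (exp (- l) - 1))"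
      by (simp add: algebra_simps flip: exp_add)
    also have "\<dots> \<le> exp l * exp (- l * (1 - p) + (- l)\<^sup>2 / 8)"
      using *[of "-l" "1 - p"] False p by simp
    also have "\<dots> = exp (l * p + l\<^sup>2 / 8)"
      by (simp add: algebra_simps flip: exp_add)
    finally show ?thesis .
  qed
qed

text \<open>The expectation of a product of coordinates under a product of Bernoulli masses: the sum
  factorizes over \<open>S\<close>, and factors outside \<open>T\<close> sum to 1.\<close>

lemma sum_PiE_bool_monomial:
  fixes q :: "'b \<Rightarrow> bool \<Rightarrow> real"
  assumes "finite S" "T \<subseteq> S" and q: "\<And>p. p \<in> S \<Longrightarrow> q p True + q p False = 1"
  shows "(\<Sum>e\<in>PiE S (\<lambda>_. UNIV). (\<Prod>p\<in>T. of_bool (e p)) * (\<Prod>p\<in>S. q p (e p))) = (\<Prod>p\<in>T. q p True)"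
proof -
  have T: "(\<Prod>p\<in>T. f p) = (\<Prod>p\<in>S. if p \<in> T then f p else 1)" for f :: "'b \<Rightarrow> real"
    using assms by (simp add: prod.If_cases Int_absorb1)
  have "(\<Sum>e\<in>PiE S (\<lambda>_. UNIV). (\<Prod>p\<in>T. of_bool (e p)) * (\<Prod>p\<in>S. q p (e p))) =
      (\<Sum>e\<in>PiE S (\<lambda>_. UNIV). \<Prod>p\<in>S. (if p \<in> T then of_bool (e p) else 1) * q p (e p))"
    by (simp add: T prod.distrib)
  also have "\<dots> = (\<Prod>p\<in>S. \<Sum>b\<in>UNIV. (if p \<in> T then of_bool b else 1) * q p b)"
    using assms by (subst prod_sum_PiE) auto
  also have "\<dots> = (\<Prod>p\<in>S. if p \<in> T then q p True else 1)"
    using q by (intro prod.cong) (auto simp: UNIV_bool add.commute)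
  finally show ?thesis by (simp add: T)
qed

lemma finite_node_pairs: "finite (node_pairs n)"
  by (rule finite_subset[of _ "{1..n} \<times> {1..n}"]) (auto simp: node_pairs_def)

lemma (in graphon) nbhd_inner_measurable: "(\<lambda>(x, y). nbhd_inner x y) \<in> borel_measurable (M \<Otimes>\<^sub>M M)"
proof -
  note [measurable] = W_measurable
  have "(\<lambda>p. \<integral>z. W (fst p) z * W (snd p) z \<partial>M) \<in> borel_measurable (M \<Otimes>\<^sub>M M)"
  proof (rule borel_measurable_lebesgue_integral)
    have 1: "(\<lambda>x. (\<lambda>(x, y). W x y) (fst (fst x), snd x)) \<in> borel_measurable ((M \<Otimes>\<^sub>M M) \<Otimes>\<^sub>M M)"
      by measurable
    have 2: "(\<lambda>x. (\<lambda>(x, y). W x y) (snd (fst x), snd x)) \<in> borel_measurable ((M \<Otimes>\<^sub>M M) \<Otimes>\<^sub>M M)"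
      by measurable
    show "(\<lambda>(p, z). W (fst p) z * W (snd p) z) \<in> borel_measurable ((M \<Otimes>\<^sub>M M) \<Otimes>\<^sub>M M)"
      using borel_measurable_times[OF 1 2] by (simp add: split_beta)
  qed
  then show ?thesis by (simp add: nbhd_inner_def split_beta)
qed

section \<open>Moments of the adjacency matrix given the latent positions\<close>

locale sampled_graphon = W_random_graph P n M W \<omega> A + G: graphon M W
  for P :: "'s measure" and n :: nat and M :: "'a measure" and W :: "'a \<Rightarrow> 'a \<Rightarrow> real"
    and \<omega> :: "'s \<Rightarrow> nat \<Rightarrow> 'a" and A :: "'s \<Rightarrow> nat \<Rightarrow> nat \<Rightarrow> real"
begin

abbreviation latent :: "'s \<Rightarrow> nat \<Rightarrow> 'a" where
  "latent s \<equiv> restrict (\<omega> s) {1..n}"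

abbreviation latent_space :: "(nat \<Rightarrow> 'a) measure" where
  "latent_space \<equiv> PiM {1..n} (\<lambda>_. M)"

lemma latent_coord_measurable: "i \<in> {1..n} \<Longrightarrow> (\<lambda>s. \<omega> s i) \<in> P \<rightarrow>\<^sub>M M"
  using latent_indep by (auto simp: indep_vars_def)

lemma latent_in_space: "s \<in> space P \<Longrightarrow> i \<in> {1..n} \<Longrightarrow> \<omega> s i \<in> space M"
  using latent_coord_measurable measurable_space by metis

lemma latent_measurable: "latent \<in> P \<rightarrow>\<^sub>M latent_space"
  by (rule measurable_restrict) (rule latent_coord_measurable)

text \<open>Independence with common law \<open>M\<close>. It turns expectations over latent
  positions into integrals over a product space, where Fubini applies.\<close>

lemma distr_latent:
  assumes "n > 0"
  shows "distr P latent_space latent = latent_space"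
proof -
  have "distr P latent_space latent = PiM {1..n} (\<lambda>i. distr P M (\<lambda>x. \<omega> x i))"
    using assms
    by (intro iffD1[OF indep_vars_iff_distr_eq_PiM' latent_indep] latent_coord_measurable) simp_all
  also have "\<dots> = latent_space"
    by (intro PiM_cong) (auto simp: latent_law)
  finally show ?thesis .
qed

lemma subalgebra_latent: "subalgebra P (latent_algebra P n M \<omega>)"
  unfolding subalgebra_def latent_algebra_def
proof (intro conjI)
  show "sets (vimage_algebra (space P) latent latent_space) \<subseteq> sets P"
    unfolding sets_vimage_algebra
    using measurable_sets[OF latent_measurable] by (intro sets.sigma_sets_subset) auto
qed simp

lemma W_coord_measurable:
  assumes "i \<in> I" "j \<in> I"
  shows "(\<lambda>w. W (w i) (w j)) \<in> borel_measurable (PiM I (\<lambda>_. M))"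
proof -
  have m: "(\<lambda>w. (w i, w j)) \<in> PiM I (\<lambda>_. M) \<rightarrow>\<^sub>M M \<Otimes>\<^sub>M M"
    using assms by measurable
  show ?thesis
    using measurable_compose[OF m G.W_measurable] by simp
qed

lemma nbhd_inner_coord_measurable:
  assumes "i \<in> I" "j \<in> I"
  shows "(\<lambda>w. G.nbhd_inner (w i) (w j)) \<in> borel_measurable (PiM I (\<lambda>_. M))"
proof -
  have m: "(\<lambda>w. (w i, w j)) \<in> PiM I (\<lambda>_. M) \<rightarrow>\<^sub>M M \<Otimes>\<^sub>M M"
    using assms by measurable
  show ?thesis
    using measurable_compose[OF m G.nbhd_inner_measurable] by simp
qed

definition config_event :: "(nat \<times> nat \<Rightarrow> bool) \<Rightarrow> 's set" where
  "config_event e = {y \<in> space P. \<forall>(i, j)\<in>node_pairs n. A y i j = of_bool (e (i, j))}"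

text \<open>The right side of assumption \<open>edges\<close> with the point masses spelled out, as
  a function of the positions alone.\<close>

definition config_mass :: "(nat \<Rightarrow> 'a) \<Rightarrow> (nat \<times> nat \<Rightarrow> bool) \<Rightarrow> real" where
  "config_mass w e = (\<Prod>p\<in>node_pairs n. if e p then W (w (fst p)) (w (snd p)) else 1 - W (w (fst p)) (w (snd p)))"

lemma node_pairs_nodes: "p \<in> node_pairs n \<Longrightarrow> fst p \<in> {1..n} \<and> snd p \<in> {1..n}"
  by (auto simp: node_pairs_def)

lemma config_event_measurable: "config_event e \<in> sets P"
  unfolding config_event_def
proof (rule sets.sets_Collect_finite_All)
  fix p assume p: "p \<in> node_pairs n"
  have "{x \<in> space P. A x (fst p) (snd p) = of_bool (e p)} \<in> sets P"
    using measurable_sets[OF A_measurable[of "fst p" "snd p"], of "{of_bool (e p)}"] node_pairs_nodes[OF p]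
    by (simp add: vimage_def Int_def conj_commute)
  then show "{x \<in> space P. case p of (i, j) \<Rightarrow> A x i j = of_bool (e (i, j))} \<in> sets P"
    by (simp add: split_beta)
qed (rule finite_node_pairs)

lemma config_mass_measurable: "(\<lambda>w. config_mass w e) \<in> borel_measurable latent_space"
  unfolding config_mass_def
proof (rule borel_measurable_prod)
  fix p assume "p \<in> node_pairs n"
  from node_pairs_nodes[OF this]
  have "(\<lambda>w. W (w (fst p)) (w (snd p))) \<in> borel_measurable latent_space"
    by (intro W_coord_measurable) simp_all
  then show "(\<lambda>w. if e p then W (w (fst p)) (w (snd p)) else 1 - W (w (fst p)) (w (snd p)))
      \<in> borel_measurable latent_space"
    by (cases "e p") simp_all
qed

lemma latent_W_range:
  assumes "w \<in> space (PiM I (\<lambda>_. M))" "i \<in> I" "j \<in> I"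
  shows "0 \<le> W (w i) (w j)" "W (w i) (w j) \<le> 1"
  using assms G.W_range[of "w i" "w j"] by (auto simp: space_PiM PiE_def)

lemma config_mass_bounds:
  assumes "w \<in> space latent_space"
  shows "0 \<le> config_mass w e" "config_mass w e \<le> 1"
  unfolding config_mass_def using latent_W_range[OF assms] node_pairs_nodes
  by (auto intro!: prod_nonneg prod_le_1)

lemma latent_space_memI: "s \<in> space P \<Longrightarrow> latent s \<in> space latent_space"
  using latent_measurable measurable_space by metis

text \<open>This is where assumption \<open>edges\<close> enters: a bounded function of the latent
  positions may be multiplied into a conditional expectation without changing the integral, and the
  conditional probability of the configuration is \<open>config_mass\<close>.\<close>

lemma expectation_config:
  fixes h :: "(nat \<Rightarrow> 'a) \<Rightarrow> real"
  assumes h[measurable]: "h \<in> borel_measurable latent_space"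
    and B: "\<And>w. w \<in> space latent_space \<Longrightarrow> \<bar>h w\<bar> \<le> B"
  shows "integrable P (\<lambda>s. h (latent s) * indicator (config_event e) s)"
    and "integrable P (\<lambda>s. h (latent s) * config_mass (latent s) e)"
    and "(\<integral>s. h (latent s) * indicator (config_event e) s \<partial>P) =
      (\<integral>s. h (latent s) * config_mass (latent s) e \<partial>P)"
proof -
  let ?F = "latent_algebra P n M \<omega>"
  interpret finite_measure_subalgebra P ?F
    by unfold_locales (rule subalgebra_latent)
  note [measurable] = latent_measurable config_event_measurable config_mass_measurable
  have hP: "(\<lambda>s. h (latent s)) \<in> borel_measurable P" by measurable
  \<comment> \<open>Measurability with respect to the smaller algebra is what the defining property
    of conditional expectation asks for.\<close>
  have hF: "(\<lambda>s. h (latent s)) \<in> borel_measurable ?F"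
    unfolding latent_algebra_def
    by (rule measurable_compose[OF measurable_vimage_algebra1 h])
      (use latent_measurable in \<open>auto simp: measurable_def\<close>)
  have cP: "(\<lambda>s. config_mass (latent s) e) \<in> borel_measurable P" by measurable
  have B': "\<bar>h (latent s)\<bar> \<le> B" if "s \<in> space P" for s
    using B latent_space_memI[OF that] by blast
  show int: "integrable P (\<lambda>s. h (latent s) * indicator (config_event e) s)"
  proof (intro integrable_const_bound[where B=B] AE_I2)
    fix s assume s: "s \<in> space P"
    then show "norm (h (latent s) * indicator (config_event e) s) \<le> B"
      using B'[OF s] by (auto simp: indicator_def)
  qed (use hP in measurable)
  show "integrable P (\<lambda>s. h (latent s) * config_mass (latent s) e)"
  proof (intro integrable_const_bound[where B=B] AE_I2)
    fix s assume s: "s \<in> space P"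
    have "\<bar>h (latent s)\<bar> * config_mass (latent s) e \<le> B * 1"
      using B'[OF s] config_mass_bounds[OF latent_space_memI[OF s]]
      by (intro mult_mono) (auto intro: order_trans[OF abs_ge_zero])
    then show "norm (h (latent s) * config_mass (latent s) e) \<le> B"
      using config_mass_bounds[OF latent_space_memI[OF s]] by (simp add: abs_mult)
  qed (use hP cP in measurable)
  have "AE s in P. real_cond_exp P ?F (indicator (config_event e)) s = config_mass (latent s) e"
    using edges[of e] AE_space
  proof eventually_elim
    case (elim s)
    have "(\<Prod>(i, j)\<in>node_pairs n. pmf (bernoulli_pmf (W (\<omega> s i) (\<omega> s j))) (e (i, j))) =
        config_mass (latent s) e"
      unfolding config_mass_def
    proof (rule prod.cong)
      fix p assume p: "p \<in> node_pairs n"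
      then have "0 \<le> W (\<omega> s (fst p)) (\<omega> s (snd p))" "W (\<omega> s (fst p)) (\<omega> s (snd p)) \<le> 1"
        using G.W_range[of "\<omega> s (fst p)" "\<omega> s (snd p)"] latent_in_space elim node_pairs_nodes[OF p]
        by auto
      then show "(case p of (i, j) \<Rightarrow> pmf (bernoulli_pmf (W (\<omega> s i) (\<omega> s j))) (e (i, j))) =
          (if e p then W (latent s (fst p)) (latent s (snd p)) else 1 - W (latent s (fst p)) (latent s (snd p)))"
        using node_pairs_nodes[OF p] by (auto simp: split_beta)
    qed simp
    then show ?case using elim by (simp add: config_event_def)
  qed
  then have AE: "AE s in P. h (latent s) * real_cond_exp P ?F (indicator (config_event e)) s =
      h (latent s) * config_mass (latent s) e"
    by eventually_elim simp
  have "(\<integral>s. h (latent s) * indicator (config_event e) s \<partial>P) =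
      (\<integral>s. h (latent s) * real_cond_exp P ?F (indicator (config_event e)) s \<partial>P)"
    by (rule real_cond_exp_intg(2)[OF int hF, symmetric]) simp
  also have "\<dots> = (\<integral>s. h (latent s) * config_mass (latent s) e \<partial>P)"
    using hP cP by (intro integral_cong_AE AE) auto
  finally show "(\<integral>s. h (latent s) * indicator (config_event e) s \<partial>P) =
      (\<integral>s. h (latent s) * config_mass (latent s) e \<partial>P)" .
qed

lemma A_nodes_01: "s \<in> space P \<Longrightarrow> p \<in> node_pairs n \<Longrightarrow> A s (fst p) (snd p) \<in> {0, 1}"
  using A_01[of s "fst p" "snd p"] node_pairs_nodes by blast

text \<open>Distinct edges are conditionally independent. The monomial is summed over all
  configurations, \<open>expectation_config\<close> is applied to each, and the masses are summed
  back.\<close>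

lemma expectation_edge_monomial:
  fixes h :: "(nat \<Rightarrow> 'a) \<Rightarrow> real"
  assumes h: "h \<in> borel_measurable latent_space" "\<And>w. w \<in> space latent_space \<Longrightarrow> \<bar>h w\<bar> \<le> B"
    and T: "T \<subseteq> node_pairs n"
  shows "(\<integral>s. h (latent s) * (\<Prod>p\<in>T. A s (fst p) (snd p)) \<partial>P) =
    (\<integral>s. h (latent s) * (\<Prod>p\<in>T. W (\<omega> s (fst p)) (\<omega> s (snd p))) \<partial>P)"
proof -
  let ?C = "PiE (node_pairs n) (\<lambda>_. UNIV :: bool set)"
  let ?c = "\<lambda>e. \<Prod>p\<in>T. of_bool (e p) :: real"
  have monoA: "(\<Prod>p\<in>T. A s (fst p) (snd p)) = (\<Sum>e\<in>?C. ?c e * indicator (config_event e) s)"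
    if s: "s \<in> space P" for s
  proof -
    \<comment> \<open>The point mass at the observed edge: its product over all node pairs is the
      indicator of \<open>config_event e\<close>, so one summation identity serves both for
      \<open>A\<close> and for \<open>W\<close>.\<close>
    define q where "q p b = (of_bool (A s (fst p) (snd p) = of_bool b) :: real)" for p :: "nat \<times> nat" and b
    have "(\<Prod>p\<in>T. A s (fst p) (snd p)) = (\<Prod>p\<in>T. q p True)"
      using A_nodes_01[OF s] T by (intro prod.cong) (fastforce simp: q_def)+
    also have "\<dots> = (\<Sum>e\<in>?C. ?c e * (\<Prod>p\<in>node_pairs n. q p (e p)))"
      using A_nodes_01[OF s] finite_node_pairs T
      by (intro sum_PiE_bool_monomial[symmetric]) (fastforce simp: q_def)+
    also have "\<dots> = (\<Sum>e\<in>?C. ?c e * indicator (config_event e) s)"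
    proof (intro sum.cong refl arg_cong2[where f="(*)"])
      fix e
      show "(\<Prod>p\<in>node_pairs n. q p (e p)) = indicator (config_event e) s"
        using s finite_node_pairs[of n]
        by (cases "\<forall>p\<in>node_pairs n. A s (fst p) (snd p) = of_bool (e p)")
          (auto simp: q_def config_event_def split_beta indicator_def intro!: prod_zero)
    qed
    finally show ?thesis .
  qed
  have monoW: "(\<Prod>p\<in>T. W (\<omega> s (fst p)) (\<omega> s (snd p))) = (\<Sum>e\<in>?C. ?c e * config_mass (latent s) e)" for s
  proof -
    define q where "q p b = (if b then W (latent s (fst p)) (latent s (snd p))
      else 1 - W (latent s (fst p)) (latent s (snd p)))" for p :: "nat \<times> nat" and b
    have "(\<Prod>p\<in>T. W (\<omega> s (fst p)) (\<omega> s (snd p))) = (\<Prod>p\<in>T. q p True)"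
      using T node_pairs_nodes by (intro prod.cong) (auto simp: q_def subset_iff)
    also have "\<dots> = (\<Sum>e\<in>?C. ?c e * (\<Prod>p\<in>node_pairs n. q p (e p)))"
      using finite_node_pairs T by (intro sum_PiE_bool_monomial[symmetric]) (auto simp: q_def)
    finally show ?thesis unfolding q_def config_mass_def .
  qed
  have "(\<integral>s. h (latent s) * (\<Prod>p\<in>T. A s (fst p) (snd p)) \<partial>P) =
      (\<integral>s. (\<Sum>e\<in>?C. ?c e * (h (latent s) * indicator (config_event e) s)) \<partial>P)"
    by (intro Bochner_Integration.integral_cong) (simp_all add: monoA sum_distrib_left mult_ac)
  also have "\<dots> = (\<Sum>e\<in>?C. ?c e * (\<integral>s. h (latent s) * indicator (config_event e) s \<partial>P))"
    using expectation_config(1)[OF h] by (subst Bochner_Integration.integral_sum) auto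
  also have "\<dots> = (\<Sum>e\<in>?C. ?c e * (\<integral>s. h (latent s) * config_mass (latent s) e \<partial>P))"
    by (simp only: expectation_config(3)[OF h])
  also have "\<dots> = (\<integral>s. (\<Sum>e\<in>?C. ?c e * (h (latent s) * config_mass (latent s) e)) \<partial>P)"
    using expectation_config(2)[OF h] by (subst Bochner_Integration.integral_sum) auto
  also have "\<dots> = (\<integral>s. h (latent s) * (\<Prod>p\<in>T. W (\<omega> s (fst p)) (\<omega> s (snd p))) \<partial>P)"
    by (intro Bochner_Integration.integral_cong) (simp_all add: monoW sum_distrib_left mult_ac)
  finally show ?thesis .
qed

text \<open>The product expands into square-free monomials in the edges, so every entry of
  \<open>A\<close> may be replaced by its conditional mean. The weight \<open>h\<close> may depend
  on all latent positions.\<close>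

lemma expectation_common_neighbours:
  fixes h :: "(nat \<Rightarrow> 'a) \<Rightarrow> real" and c :: real
  assumes h: "h \<in> borel_measurable latent_space" "\<And>w. w \<in> space latent_space \<Longrightarrow> \<bar>h w\<bar> \<le> B"
    and ij: "i \<in> {1..n}" "j \<in> {1..n}" "i \<noteq> j"
  shows "(\<integral>s. h (latent s) * (\<Prod>k\<in>{1..n} - {i, j}. 1 + c * (A s i k * A s j k)) \<partial>P) =
    (\<integral>s. h (latent s) * (\<Prod>k\<in>{1..n} - {i, j}. 1 + c * (W (\<omega> s i) (\<omega> s k) * W (\<omega> s j) (\<omega> s k))) \<partial>P)"
proof -
  let ?K = "{1..n} - {i, j}"
  \<comment> \<open>The model describes entries above the diagonal only; ordering the pair gives
    such an entry, and symmetry gives back the original value.\<close>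
  define pair where "pair a b = (min a b, max a b)" for a b :: nat
  define T where "T S = (\<lambda>(a, k). pair a k) ` ({i, j} \<times> S)" for S
  have T: "T S \<subseteq> node_pairs n" if "S \<subseteq> ?K" for S
  proof
    fix p assume "p \<in> T S"
    then obtain a k where p: "p = pair a k" "a \<in> {i, j}" "k \<in> S" by (auto simp: T_def)
    then have "k \<in> {1..n}" "a \<noteq> k" "a \<in> {1..n}" using that ij by auto
    then show "p \<in> node_pairs n" by (auto simp: p pair_def node_pairs_def min_def max_def)
  qed
  have prod_T: "(\<Prod>p\<in>T S. f (fst p) (snd p)) = (\<Prod>k\<in>S. f i k * f j k)"
    if S: "S \<subseteq> ?K" and sym: "\<And>a b. a \<in> {1..n} \<Longrightarrow> b \<in> {1..n} \<Longrightarrow> f b a = f a b"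
    for S and f :: "nat \<Rightarrow> nat \<Rightarrow> real"
  proof -
    \<comment> \<open>An unordered pair determines \<open>(a, k)\<close> because \<open>S\<close>
      avoids \<open>i\<close> and \<open>j\<close>; hence no edge occurs twice.\<close>
    have "inj_on (\<lambda>(a, k). pair a k) ({i, j} \<times> S)"
    proof -
      have "i \<notin> S" "j \<notin> S" using S by auto
      then show ?thesis by (auto simp: inj_on_def pair_def min_def max_def split: if_splits)
    qed
    then have "(\<Prod>p\<in>T S. f (fst p) (snd p)) = (\<Prod>(a, k)\<in>{i, j} \<times> S. f (fst (pair a k)) (snd (pair a k)))"
      unfolding T_def by (subst prod.reindex) (auto intro!: prod.cong)
    also have "\<dots> = (\<Prod>(a, k)\<in>{i, j} \<times> S. f a k)"
    proof (rule prod.cong)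
      fix p assume "p \<in> {i, j} \<times> S"
      then have "fst p \<in> {1..n}" "snd p \<in> {1..n}" using S ij by auto
      then show "(case p of (a, k) \<Rightarrow> f (fst (pair a k)) (snd (pair a k))) = (case p of (a, k) \<Rightarrow> f a k)"
        using sym by (auto simp: pair_def min_def max_def split_beta)
    qed simp
    also have "\<dots> = (\<Prod>a\<in>{i, j}. \<Prod>k\<in>S. f a k)"
      by (simp add: prod.cartesian_product)
    also have "\<dots> = (\<Prod>k\<in>S. f i k * f j k)"
      using ij by (simp add: prod.distrib)
    finally show ?thesis .
  qed
  have expand: "(\<Prod>k\<in>?K. 1 + c * f k) = (\<Sum>S\<in>Pow ?K. c ^ card S * (\<Prod>k\<in>S. f k))" for f :: "nat \<Rightarrow> real"
    using prod_add[of ?K "\<lambda>k. c * f k" "\<lambda>_. 1"] by (simp add: prod.distrib add.commute)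
  \<comment> \<open>The expectation of the expanded product is known: the \<open>2 * card S\<close> edges in \<open>T S\<close> are distinct.\<close>
  have A_mono: "(\<Prod>k\<in>S. A s i k * A s j k) = (\<Prod>p\<in>T S. A s (fst p) (snd p))"
    if "s \<in> space P" "S \<subseteq> ?K" for s S
    using that A_sym by (intro prod_T[symmetric]) auto
  have W_mono: "(\<Prod>k\<in>S. W (\<omega> s i) (\<omega> s k) * W (\<omega> s j) (\<omega> s k)) =
      (\<Prod>p\<in>T S. W (\<omega> s (fst p)) (\<omega> s (snd p)))"
    if "s \<in> space P" "S \<subseteq> ?K" for s S
    using that G.W_sym latent_in_space
    by (intro prod_T[of S "\<lambda>a b. W (\<omega> s a) (\<omega> s b)", symmetric]) auto
  have A_prod: "h (latent s) * (\<Prod>k\<in>?K. 1 + c * (A s i k * A s j k)) =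
      (\<Sum>S\<in>Pow ?K. c ^ card S * (h (latent s) * (\<Prod>p\<in>T S. A s (fst p) (snd p))))" if s: "s \<in> space P" for s
  proof -
    have "(\<Prod>k\<in>?K. 1 + c * (A s i k * A s j k)) = (\<Sum>S\<in>Pow ?K. c ^ card S * (\<Prod>p\<in>T S. A s (fst p) (snd p)))"
      unfolding expand using A_mono[OF s] by (intro sum.cong) auto
    then show ?thesis by (simp only: sum_distrib_left mult.left_commute)
  qed
  have W_prod: "h (latent s) * (\<Prod>k\<in>?K. 1 + c * (W (\<omega> s i) (\<omega> s k) * W (\<omega> s j) (\<omega> s k))) =
      (\<Sum>S\<in>Pow ?K. c ^ card S * (h (latent s) * (\<Prod>p\<in>T S. W (\<omega> s (fst p)) (\<omega> s (snd p)))))" if s: "s \<in> space P" for s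
  proof -
    have "(\<Prod>k\<in>?K. 1 + c * (W (\<omega> s i) (\<omega> s k) * W (\<omega> s j) (\<omega> s k))) = (\<Sum>S\<in>Pow ?K. c ^ card S * (\<Prod>p\<in>T S. W (\<omega> s (fst p)) (\<omega> s (snd p))))"
      unfolding expand using W_mono[OF s] by (intro sum.cong) auto
    then show ?thesis by (simp only: sum_distrib_left mult.left_commute)
  qed
  have B: "\<bar>h (latent s)\<bar> \<le> B" if "s \<in> space P" for s
    using h(2) latent_space_memI[OF that] by blast
  have hP: "(\<lambda>s. h (latent s)) \<in> borel_measurable P"
    using latent_measurable h(1) by measurable
  have bounded: "integrable P (\<lambda>s. h (latent s) * (\<Prod>p\<in>T S. g s p))"
    if g: "\<And>s p. s \<in> space P \<Longrightarrow> p \<in> node_pairs n \<Longrightarrow> 0 \<le> g s p \<and> g s p \<le> 1"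
      and gm: "\<And>p. p \<in> node_pairs n \<Longrightarrow> (\<lambda>s. g s p) \<in> borel_measurable P"
      and S: "S \<subseteq> ?K" for S and g :: "'s \<Rightarrow> nat \<times> nat \<Rightarrow> real"
  proof (intro integrable_const_bound[where B=B] AE_I2)
    fix s assume s: "s \<in> space P"
    have "\<bar>h (latent s)\<bar> * (\<Prod>p\<in>T S. g s p) \<le> B * 1"
      using g[OF s] T[OF S] B[OF s]
      by (intro mult_mono prod_le_1 prod_nonneg) (auto intro: order_trans[OF abs_ge_zero])
    moreover have "0 \<le> (\<Prod>p\<in>T S. g s p)" using g[OF s] T[OF S] by (intro prod_nonneg) auto
    ultimately show "norm (h (latent s) * (\<Prod>p\<in>T S. g s p)) \<le> B" by (simp add: abs_mult)
  next
    show "(\<lambda>s. h (latent s) * (\<Prod>p\<in>T S. g s p)) \<in> borel_measurable P"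
      using gm T[OF S] by (intro borel_measurable_times hP borel_measurable_prod) auto
  qed
  have intA: "integrable P (\<lambda>s. h (latent s) * (\<Prod>p\<in>T S. A s (fst p) (snd p)))" if "S \<subseteq> ?K" for S
  proof (rule bounded[OF _ _ that])
    show "0 \<le> A s (fst p) (snd p) \<and> A s (fst p) (snd p) \<le> 1" if "s \<in> space P" "p \<in> node_pairs n" for s p
      using A_nodes_01[OF that] by auto
    show "(\<lambda>s. A s (fst p) (snd p)) \<in> borel_measurable P" if "p \<in> node_pairs n" for p
      using A_measurable node_pairs_nodes[OF that] by simp
  qed
  have intW: "integrable P (\<lambda>s. h (latent s) * (\<Prod>p\<in>T S. W (\<omega> s (fst p)) (\<omega> s (snd p))))" if "S \<subseteq> ?K" for S
  proof (rule bounded[OF _ _ that])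
    fix p assume p: "p \<in> node_pairs n"
    have "(\<lambda>s. W (latent s (fst p)) (latent s (snd p))) \<in> borel_measurable P"
      using node_pairs_nodes[OF p]
      by (intro measurable_compose[OF latent_measurable W_coord_measurable]) simp_all
    then show "(\<lambda>s. W (\<omega> s (fst p)) (\<omega> s (snd p))) \<in> borel_measurable P"
      using node_pairs_nodes[OF p] by simp
  next
    show "0 \<le> W (\<omega> s (fst p)) (\<omega> s (snd p)) \<and> W (\<omega> s (fst p)) (\<omega> s (snd p)) \<le> 1"
      if "s \<in> space P" "p \<in> node_pairs n" for s p
      using G.W_range latent_in_space that node_pairs_nodes[OF that(2)] by simp
  qed
  have "(\<integral>s. h (latent s) * (\<Prod>k\<in>?K. 1 + c * (A s i k * A s j k)) \<partial>P) =
      (\<integral>s. (\<Sum>S\<in>Pow ?K. c ^ card S * (h (latent s) * (\<Prod>p\<in>T S. A s (fst p) (snd p)))) \<partial>P)"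
    by (intro Bochner_Integration.integral_cong refl) (simp only: A_prod)
  also have "\<dots> = (\<Sum>S\<in>Pow ?K. c ^ card S * (\<integral>s. h (latent s) * (\<Prod>p\<in>T S. A s (fst p) (snd p)) \<partial>P))"
    using intA by (subst Bochner_Integration.integral_sum) auto
  also have "\<dots> = (\<Sum>S\<in>Pow ?K. c ^ card S * (\<integral>s. h (latent s) * (\<Prod>p\<in>T S. W (\<omega> s (fst p)) (\<omega> s (snd p))) \<partial>P))"
    using expectation_edge_monomial[OF h T] by (intro sum.cong) auto
  also have "\<dots> = (\<integral>s. (\<Sum>S\<in>Pow ?K. c ^ card S * (h (latent s) * (\<Prod>p\<in>T S. W (\<omega> s (fst p)) (\<omega> s (snd p))))) \<partial>P)"
    using intW by (subst Bochner_Integration.integral_sum) auto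
  also have "\<dots> = (\<integral>s. h (latent s) * (\<Prod>k\<in>?K. 1 + c * (W (\<omega> s i) (\<omega> s k) * W (\<omega> s j) (\<omega> s k))) \<partial>P)"
    by (intro Bochner_Integration.integral_cong refl) (simp only: W_prod)
  finally show ?thesis .
qed

text \<open>On \<open>{0, 1}\<close> the exponential is affine,
  \<open>exp (l * x) = 1 + (exp l - 1) * x\<close>, which gives the product of
  \<open>expectation_common_neighbours\<close>. The centring depends on the positions of
  \<open>i\<close> and \<open>j\<close> only and becomes the weight \<open>h\<close>. The other
  positions are integrated out first, by Fubini.\<close>

lemma common_neighbours_mgf_le:
  fixes l :: real
  assumes ij: "i \<in> {1..n}" "j \<in> {1..n}" "i \<noteq> j"
  defines "K \<equiv> {1..n} - {i, j}"
  shows "(\<integral>s. exp (l * ((\<Sum>k\<in>K. A s i k * A s j k) - card K * G.nbhd_inner (\<omega> s i) (\<omega> s j))) \<partial>P)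
    \<le> exp (card K * l\<^sup>2 / 8)"
proof -
  let ?c = "exp l - 1"
  define h where "h w = exp (- (l * (card K * G.nbhd_inner (w i) (w j))))" for w :: "nat \<Rightarrow> 'a"
  define F where "F w = h w * (\<Prod>k\<in>K. 1 + ?c * (W (w i) (w k) * W (w j) (w k)))" for w :: "nat \<Rightarrow> 'a"
  have n: "n > 0" using ij by auto
  have Iij: "{i, j} \<union> K = {1..n}" "{i, j} \<inter> K = {}" "finite K"
    using ij by (auto simp: K_def)
  have h_meas: "h \<in> borel_measurable (PiM I (\<lambda>_. M))" if "i \<in> I" "j \<in> I" for I
    unfolding h_def using nbhd_inner_coord_measurable[OF that] by measurable
  have h_bound: "\<bar>h w\<bar> \<le> exp (\<bar>l\<bar> * card K)" if "w \<in> space (PiM I (\<lambda>_. M))" "i \<in> I" "j \<in> I" for w I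
  proof -
    have q01: "0 \<le> G.nbhd_inner (w i) (w j)" "G.nbhd_inner (w i) (w j) \<le> 1"
      using G.nbhd_inner_bounds[of "w i" "w j"] that by (auto simp: space_PiM PiE_def Pi_iff)
    have "- (l * (card K * G.nbhd_inner (w i) (w j))) \<le> \<bar>l\<bar> * (card K * G.nbhd_inner (w i) (w j))"
      using q01 abs_ge_minus_self[of "l * (card K * G.nbhd_inner (w i) (w j))"] by (simp add: abs_mult)
    also have "\<dots> \<le> \<bar>l\<bar> * (card K * 1)"
      using q01 by (intro mult_left_mono) (auto simp: mult_left_le)
    finally show ?thesis by (simp add: h_def)
  qed
  have prod_bound: "0 \<le> 1 + ?c * (W x z * W y z)" "1 + ?c * (W x z * W y z) \<le> exp \<bar>l\<bar>"
    if "x \<in> space M" "y \<in> space M" "z \<in> space M" for x y z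
  proof -
    have q: "0 \<le> W x z * W y z" "W x z * W y z \<le> 1"
      using G.W_range that by (auto intro!: mult_le_one)
    have "0 \<le> (1 - W x z * W y z) + exp l * (W x z * W y z)"
      using q mult_nonneg_nonneg[OF exp_ge_zero q(1), of l] by linarith
    then show "0 \<le> 1 + ?c * (W x z * W y z)" by (simp add: algebra_simps)
    have "(1 - W x z * W y z) * 1 + (W x z * W y z) * exp l
        \<le> (1 - W x z * W y z) * exp \<bar>l\<bar> + (W x z * W y z) * exp \<bar>l\<bar>"
      using q by (intro add_mono mult_left_mono) auto
    then show "1 + ?c * (W x z * W y z) \<le> exp \<bar>l\<bar>" by (simp add: algebra_simps)
  qed
  have F_meas: "F \<in> borel_measurable latent_space"
    unfolding F_def using ij
    by (intro borel_measurable_times h_meas borel_measurable_prod borel_measurable_add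
        borel_measurable_const W_coord_measurable) (simp_all add: K_def)
  have F_int: "integrable latent_space F"
  proof -
    interpret L: prob_space latent_space
      by (rule prob_space_PiM) (rule G.prob_space_axioms)
    show ?thesis
    proof (intro L.integrable_const_bound[where B="exp (\<bar>l\<bar> * card K) * exp \<bar>l\<bar> ^ card K"] AE_I2)
      fix w assume w: "w \<in> space latent_space"
      have mem: "w k \<in> space M" if "k \<in> {1..n}" for k
        using w that by (auto simp: space_PiM PiE_def)
      have P0: "0 \<le> (\<Prod>k\<in>K. 1 + ?c * (W (w i) (w k) * W (w j) (w k)))"
        using mem ij prod_bound by (intro prod_nonneg) (auto simp: K_def)
      have "(\<Prod>k\<in>K. 1 + ?c * (W (w i) (w k) * W (w j) (w k))) \<le> (\<Prod>k\<in>K. exp \<bar>l\<bar>)"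
        using mem ij prod_bound by (intro prod_mono) (auto simp: K_def)
      then have "\<bar>F w\<bar> \<le> exp (\<bar>l\<bar> * card K) * (\<Prod>k\<in>K. exp \<bar>l\<bar>)"
        unfolding F_def abs_mult using h_bound[OF w ij(1,2)] P0 by (intro mult_mono) auto
      then show "norm (F w) \<le> exp (\<bar>l\<bar> * card K) * exp \<bar>l\<bar> ^ card K" by simp
    qed (rule F_meas)
  qed
  have "(\<integral>s. exp (l * ((\<Sum>k\<in>K. A s i k * A s j k) - card K * G.nbhd_inner (\<omega> s i) (\<omega> s j))) \<partial>P) =
      (\<integral>s. h (latent s) * (\<Prod>k\<in>K. 1 + ?c * (A s i k * A s j k)) \<partial>P)"
  proof (intro Bochner_Integration.integral_cong refl)
    fix s assume s: "s \<in> space P"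
    have "exp (l * (\<Sum>k\<in>K. A s i k * A s j k)) = (\<Prod>k\<in>K. exp (l * (A s i k * A s j k)))"
      using Iij by (simp add: sum_distrib_left exp_sum)
    also have "\<dots> = (\<Prod>k\<in>K. 1 + ?c * (A s i k * A s j k))"
    proof (rule prod.cong)
      fix k assume "k \<in> K"
      then have "k \<in> {1..n}" by (simp add: K_def)
      with A_01[OF s ij(1)] A_01[OF s ij(2)] have "A s i k \<in> {0, 1}" "A s j k \<in> {0, 1}" by blast+
      then show "exp (l * (A s i k * A s j k)) = 1 + ?c * (A s i k * A s j k)" by auto
    qed simp
    finally show "exp (l * ((\<Sum>k\<in>K. A s i k * A s j k) - card K * G.nbhd_inner (\<omega> s i) (\<omega> s j))) =
        h (latent s) * (\<Prod>k\<in>K. 1 + ?c * (A s i k * A s j k))"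
      using ij by (simp add: h_def right_diff_distrib exp_diff exp_minus field_simps)
  qed
  also have "\<dots> = (\<integral>s. h (latent s) * (\<Prod>k\<in>K. 1 + ?c * (W (\<omega> s i) (\<omega> s k) * W (\<omega> s j) (\<omega> s k))) \<partial>P)"
    unfolding K_def by (rule expectation_common_neighbours[OF h_meas h_bound]) (use ij in auto)
  also have "\<dots> = (\<integral>s. F (latent s) \<partial>P)"
    unfolding F_def using ij
    by (intro Bochner_Integration.integral_cong refl arg_cong2[where f="(*)"] prod.cong) (auto simp: K_def)
  also have "\<dots> = (\<integral>w. F w \<partial>latent_space)"
    using integral_distr[OF latent_measurable F_meas] by (simp only: distr_latent[OF n])
  also have "\<dots> = (\<integral>x. (\<integral>y. F (merge {i, j} K (x, y)) \<partial>PiM K (\<lambda>_. M)) \<partial>PiM {i, j} (\<lambda>_. M))"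
  proof -
    interpret product_sigma_finite "\<lambda>_::nat. M"
      by (simp add: product_sigma_finite_def G.sigma_finite_measure_axioms)
    show ?thesis
      using product_integral_fold[OF Iij(2) _ Iij(3), of F] F_int unfolding Iij(1) by simp
  qed
  also have "\<dots> \<le> (\<integral>x. exp (card K * l\<^sup>2 / 8) \<partial>PiM {i, j} (\<lambda>_. M))"
  proof (rule integral_mono')
    interpret L: prob_space "PiM {i, j} (\<lambda>_. M)"
      by (rule prob_space_PiM) (rule G.prob_space_axioms)
    show "integrable (PiM {i, j} (\<lambda>_. M)) (\<lambda>x. exp (card K * l\<^sup>2 / 8))" by simp
    fix x assume x: "x \<in> space (PiM {i, j} (\<lambda>_. M))"
    then have xm: "x i \<in> space M" "x j \<in> space M" by (auto simp: space_PiM)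
    let ?p = "G.nbhd_inner (x i) (x j)"
    note p = G.nbhd_inner_bounds[OF xm]
    interpret product_sigma_finite "\<lambda>_::nat. M"
      by (simp add: product_sigma_finite_def G.sigma_finite_measure_axioms)
    have "(\<integral>y. F (merge {i, j} K (x, y)) \<partial>PiM K (\<lambda>_. M)) =
        (\<integral>y. h x * (\<Prod>k\<in>K. 1 + ?c * (W (x i) (y k) * W (x j) (y k))) \<partial>PiM K (\<lambda>_. M))"
      using Iij(2) by (intro Bochner_Integration.integral_cong refl)
        (auto simp: F_def h_def merge_def intro!: prod.cong)
    also have "\<dots> = h x * (\<integral>y. (\<Prod>k\<in>K. 1 + ?c * (W (x i) (y k) * W (x j) (y k))) \<partial>PiM K (\<lambda>_. M))"
      by simp
    \<comment> \<open>With \<open>x\<close> fixed the coordinates of \<open>y\<close> are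
      independent, and each factor integrates to the Bernoulli moment generating function with
      parameter \<open>?p\<close>.\<close>
    also have "(\<integral>y. (\<Prod>k\<in>K. 1 + ?c * (W (x i) (y k) * W (x j) (y k))) \<partial>PiM K (\<lambda>_. M)) =
        (\<Prod>k\<in>K. \<integral>z. 1 + ?c * (W (x i) z * W (x j) z) \<partial>M)"
      using Iij(3) G.W_mult_integrable[OF xm] by (intro product_integral_prod) auto
    also have "\<dots> = (1 + ?p * ?c) ^ card K"
      using G.W_mult_integrable[OF xm] by (simp add: G.nbhd_inner_def G.prob_space mult.commute)
    also have "h x * \<dots> \<le> h x * exp (l * ?p + l\<^sup>2 / 8) ^ card K"
    proof (intro mult_left_mono power_mono Hoeffding_bernoulli p)
      have "0 \<le> (1 - ?p) + ?p * exp l" using p by (intro add_nonneg_nonneg mult_nonneg_nonneg) auto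
      then show "0 \<le> 1 + ?p * ?c" by (simp add: algebra_simps)
    qed (simp add: h_def)
    \<comment> \<open>The weight \<open>h x\<close> cancels the linear term in the exponent.\<close>
    also have "\<dots> = exp (card K * l\<^sup>2 / 8)"
      by (simp add: h_def algebra_simps flip: exp_of_nat_mult exp_add)
    finally show "(\<integral>y. F (merge {i, j} K (x, y)) \<partial>PiM K (\<lambda>_. M)) \<le> exp (card K * l\<^sup>2 / 8)" .
  qed simp
  also have "\<dots> = exp (card K * l\<^sup>2 / 8)"
  proof -
    interpret L: prob_space "PiM {i, j} (\<lambda>_. M)"
      by (rule prob_space_PiM) (rule G.prob_space_axioms)
    show ?thesis by (simp add: L.prob_space)
  qed
  finally show ?thesis .
qed

end

text \<open>Since \<open>exp 1 \<le> 3\<close>. It is needed to absorb the additive constant of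
  \<open>row_inner_excess\<close> into the deviation.\<close>

lemma ln_ge_1:
  assumes "(n::nat) \<ge> 3"
  shows "1 \<le> ln (real n)"
proof -
  have "exp 1 \<le> real n" using exp_le assms by linarith
  then show ?thesis using assms by (simp add: ln_ge_iff)
qed

section \<open>Tail bounds for row products and the union bound\<close>

context sampled_graphon begin

lemma nbhd_inner_latent_measurable:
  assumes "i \<in> {1..n}" "j \<in> {1..n}"
  shows "(\<lambda>s. G.nbhd_inner (\<omega> s i) (\<omega> s j)) \<in> borel_measurable P"
proof -
  have "(\<lambda>s. G.nbhd_inner (latent s i) (latent s j)) \<in> borel_measurable P"
    using assms by (intro measurable_compose[OF latent_measurable nbhd_inner_coord_measurable])
  then show ?thesis using assms by simp
qed

lemma row_inner_measurable:
  assumes "i \<in> {1..n}" "j \<in> {1..n}"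
  shows "(\<lambda>s. row_inner n (A s i) (A s j)) \<in> borel_measurable P"
  unfolding row_inner_def using assms A_measurable
  by (intro borel_measurable_times borel_measurable_sum borel_measurable_const) simp_all

text \<open>The common neighbour count minus its conditional mean given the positions of
  \<open>i\<close> and \<open>j\<close>. It is left unnormalized, as it has \<open>n - 2\<close>
  summands while \<open>row_inner\<close> divides by \<open>n\<close>.\<close>

definition excess :: "nat \<Rightarrow> nat \<Rightarrow> 's \<Rightarrow> real" where
  "excess i j s = (\<Sum>k\<in>{1..n} - {i, j}. A s i k * A s j k) -
    card ({1..n} - {i, j}) * G.nbhd_inner (\<omega> s i) (\<omega> s j)"

lemma excess_measurable:
  assumes "i \<in> {1..n}" "j \<in> {1..n}"
  shows "excess i j \<in> borel_measurable P"
  unfolding excess_def[abs_def] using assms A_measurable nbhd_inner_latent_measurable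
  by (intro borel_measurable_times borel_measurable_diff borel_measurable_sum borel_measurable_const) simp_all

text \<open>Supplies the integrability of the exponential in \<open>excess_tail\<close>.\<close>

lemma abs_excess_le:
  assumes s: "s \<in> space P" and ij: "i \<in> {1..n}" "j \<in> {1..n}"
  shows "\<bar>excess i j s\<bar> \<le> card ({1..n} - {i, j})"
proof -
  let ?K = "{1..n} - {i, j}"
  have a: "0 \<le> A s i k * A s j k \<and> A s i k * A s j k \<le> 1" if "k \<in> ?K" for k
    using A_01[OF s ij(1), of k] A_01[OF s ij(2), of k] that by auto
  have "0 \<le> (\<Sum>k\<in>?K. A s i k * A s j k)" using a by (intro sum_nonneg) auto
  moreover have "(\<Sum>k\<in>?K. A s i k * A s j k) \<le> card ?K"
    using sum_bounded_above[of ?K "\<lambda>k. A s i k * A s j k" 1] a by simp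
  moreover have "0 \<le> card ?K * G.nbhd_inner (\<omega> s i) (\<omega> s j)" "card ?K * G.nbhd_inner (\<omega> s i) (\<omega> s j) \<le> card ?K"
    using G.nbhd_inner_bounds[OF latent_in_space[OF s ij(1)] latent_in_space[OF s ij(2)]]
    by (simp_all add: mult_left_le)
  ultimately show ?thesis unfolding excess_def by linarith
qed

text \<open>Chernoff's method, with \<open>\<sigma>\<close> selecting the tail. The parameter
  \<open>4 * t\<close> minimizes \<open>n * l\<^sup>2 / 8 - l * n * t\<close> over \<open>l\<close>;
  the number of summands is bounded by \<open>n\<close>.\<close>

lemma excess_tail:
  fixes t \<sigma> :: real
  assumes ij: "i \<in> {1..n}" "j \<in> {1..n}" "i \<noteq> j" and t: "0 \<le> t" and \<sigma>: "\<sigma> \<in> {1, -1}"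
  shows "prob {s \<in> space P. n * t \<le> \<sigma> * excess i j s} \<le> exp (- (2 * n * t\<^sup>2))"
proof -
  let ?K = "{1..n} - {i, j}"
  let ?u = "\<lambda>s. exp (4 * t * \<sigma> * excess i j s)"
  have u_meas: "?u \<in> borel_measurable P"
    using excess_measurable[OF ij(1,2)] by measurable
  have "integrable P ?u"
  proof (intro integrable_const_bound[where B="exp (4 * t * card ?K)"] AE_I2 u_meas)
    fix s assume s: "s \<in> space P"
    have "\<sigma> * excess i j s \<le> card ?K" using abs_excess_le[OF s ij(1,2)] \<sigma> by auto
    then have "4 * t * (\<sigma> * excess i j s) \<le> 4 * t * card ?K" using t by (intro mult_left_mono) auto
    then show "norm (?u s) \<le> exp (4 * t * card ?K)" by (simp add: mult.assoc)
  qed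
  then have "prob {s \<in> space P. ?u s \<ge> exp (4 * n * t\<^sup>2)} \<le> (\<integral>s. ?u s \<partial>P) / exp (4 * n * t\<^sup>2)"
    by (rule integral_Markov_inequality_measure[OF _ sets.empty_sets]) auto
  also have "\<dots> \<le> exp (2 * n * t\<^sup>2) / exp (4 * n * t\<^sup>2)"
  proof (rule divide_right_mono)
    have "(\<integral>s. ?u s \<partial>P) \<le> exp (card ?K * (4 * t * \<sigma>)\<^sup>2 / 8)"
      using common_neighbours_mgf_le[OF ij, of "4 * t * \<sigma>"] by (simp only: excess_def)
    also have "card ?K * (4 * t * \<sigma>)\<^sup>2 / 8 = card ?K * (2 * t\<^sup>2)"
      using \<sigma> by (auto simp: power_mult_distrib)
    also have "exp \<dots> \<le> exp (n * (2 * t\<^sup>2))"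
      using card_Diff1_le[of "{1..n}"] card_mono[of "{1..n}" ?K] by (simp add: mult_right_mono)
    finally show "(\<integral>s. ?u s \<partial>P) \<le> exp (2 * n * t\<^sup>2)" by (simp add: mult_ac)
  qed simp
  also have "\<dots> = exp (- (2 * n * t\<^sup>2))"
    by (simp flip: exp_diff)
  finally have *: "prob {s \<in> space P. ?u s \<ge> exp (4 * n * t\<^sup>2)} \<le> exp (- (2 * n * t\<^sup>2))" .
  have "prob {s \<in> space P. n * t \<le> \<sigma> * excess i j s} \<le> prob {s \<in> space P. ?u s \<ge> exp (4 * n * t\<^sup>2)}"
  proof (rule finite_measure_mono)
    show "{s \<in> space P. ?u s \<ge> exp (4 * n * t\<^sup>2)} \<in> events"
      using u_meas by measurable
    show "{s \<in> space P. n * t \<le> \<sigma> * excess i j s} \<subseteq> {s \<in> space P. ?u s \<ge> exp (4 * n * t\<^sup>2)}"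
    proof
      fix s assume "s \<in> {s \<in> space P. n * t \<le> \<sigma> * excess i j s}"
      then have s: "s \<in> space P" and "n * t \<le> \<sigma> * excess i j s" by auto
      then have "4 * t * (n * t) \<le> 4 * t * (\<sigma> * excess i j s)" using t by (intro mult_left_mono) auto
      then show "s \<in> {s \<in> space P. ?u s \<ge> exp (4 * n * t\<^sup>2)}"
        using s by (simp add: power2_eq_square mult_ac)
    qed
  qed
  then show ?thesis using * by linarith
qed

text \<open>The terms \<open>k = i\<close> and \<open>k = j\<close> vanish because the diagonal is
  zero. Dividing by \<open>n\<close> instead of \<open>n - 2\<close> leaves a discrepancy of twice
  the inner product, hence at most 2.\<close>

lemma row_inner_excess:
  assumes s: "s \<in> space P" and ij: "i \<in> {1..n}" "j \<in> {1..n}" "i \<noteq> j"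
  shows "n * \<bar>row_inner n (A s i) (A s j) - G.nbhd_inner (\<omega> s i) (\<omega> s j)\<bar> \<le> \<bar>excess i j s\<bar> + 2"
proof -
  let ?K = "{1..n} - {i, j}" and ?p = "G.nbhd_inner (\<omega> s i) (\<omega> s j)"
  have n: "n > 0" using ij by auto
  have "(\<Sum>k=1..n. A s i k * A s j k) = (\<Sum>k\<in>?K. A s i k * A s j k)"
    using A_diag[OF s] ij by (intro sum.mono_neutral_right) auto
  then have r: "n * row_inner n (A s i) (A s j) = (\<Sum>k\<in>?K. A s i k * A s j k)"
    using n by (simp add: row_inner_def)
  have "card ?K = n - 2" using ij by (simp add: card_Diff_subset)
  moreover have "2 \<le> n" using card_mono[of "{1..n}" "{i, j}"] ij by auto
  ultimately have "excess i j s = n * row_inner n (A s i) (A s j) - (real n - 2) * ?p"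
    unfolding excess_def r by (simp add: of_nat_diff)
  then have *: "n * (row_inner n (A s i) (A s j) - ?p) = excess i j s - 2 * ?p"
    by (simp add: algebra_simps)
  have "n * \<bar>row_inner n (A s i) (A s j) - ?p\<bar> = \<bar>n * (row_inner n (A s i) (A s j) - ?p)\<bar>"
    by (simp add: abs_mult)
  also have "\<dots> \<le> \<bar>excess i j s\<bar> + 2"
    unfolding * using G.nbhd_inner_bounds[OF latent_in_space[OF s ij(1)] latent_in_space[OF s ij(2)]] by linarith
  finally show ?thesis .
qed

definition deviation_event :: "real \<Rightarrow> nat \<Rightarrow> nat \<Rightarrow> 's set" where
  "deviation_event \<delta> i j = {s \<in> space P. \<delta> < \<bar>row_inner n (A s i) (A s j) - G.nbhd_inner (\<omega> s i) (\<omega> s j)\<bar>}"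

lemma deviation_event_measurable:
  assumes "i \<in> {1..n}" "j \<in> {1..n}"
  shows "deviation_event \<delta> i j \<in> events"
  unfolding deviation_event_def
  using row_inner_measurable[OF assms] nbhd_inner_latent_measurable[OF assms] by measurable

lemma prob_deviation_event:
  assumes ij: "i \<in> {1..n}" "j \<in> {1..n}" "i \<noteq> j" and n: "n \<ge> 3"
  shows "prob (deviation_event (3 * sqrt (ln n / n)) i j) \<le> 2 / n ^ 3"
proof -
  \<comment> \<open>Half of the allowed deviation: one half is left for the tail of
    \<open>excess\<close>, the other absorbs the constant 2 of
    \<open>row_inner_excess\<close>.\<close>
  define t where "t = 3 / 2 * sqrt (ln n / n)"
  have t: "0 \<le> t" using n by (simp add: t_def)
  have t2: "2 * n * t\<^sup>2 = 9 / 2 * ln n"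
    using n by (simp add: t_def power_mult_distrib power2_eq_square)
  \<comment> \<open>The square of \<open>n * t\<close> is \<open>9 / 4 * n * ln n\<close>, at least
    \<open>27 / 4\<close>.\<close>
  have "2 \<le> n * t"
  proof -
    have "(2::real)\<^sup>2 \<le> 9 / 4 * (3 * 1)" by simp
    also have "\<dots> \<le> 9 / 4 * (n * ln n)" using ln_ge_1[OF n] n by (intro mult_left_mono mult_mono) auto
    also have "\<dots> = (n * t)\<^sup>2" using t2 n by (simp add: power2_eq_square field_simps)
    finally show ?thesis using t by (intro power2_le_imp_le[of 2 "n * t"]) simp_all
  qed
  have sub: "deviation_event (3 * sqrt (ln n / n)) i j \<subseteq>
      {s \<in> space P. n * t \<le> 1 * excess i j s} \<union> {s \<in> space P. n * t \<le> -1 * excess i j s}" (is "_ \<subseteq> ?B")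
  proof
    fix s assume "s \<in> deviation_event (3 * sqrt (ln n / n)) i j"
    then have s: "s \<in> space P" and "2 * t < \<bar>row_inner n (A s i) (A s j) - G.nbhd_inner (\<omega> s i) (\<omega> s j)\<bar>"
      by (auto simp: deviation_event_def t_def)
    then have "n * (2 * t) \<le> n * \<bar>row_inner n (A s i) (A s j) - G.nbhd_inner (\<omega> s i) (\<omega> s j)\<bar>"
      by (intro mult_left_mono) auto
    also have "\<dots> \<le> \<bar>excess i j s\<bar> + 2" by (rule row_inner_excess[OF s ij])
    finally have "n * t \<le> \<bar>excess i j s\<bar>" using \<open>2 \<le> n * t\<close> by linarith
    then show "s \<in> ?B" using s by (auto simp: abs_if split: if_splits)
  qed
  have m: "{s \<in> space P. n * t \<le> c * excess i j s} \<in> events" for c :: real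
    using excess_measurable[OF ij(1,2)] by measurable
  have "prob (deviation_event (3 * sqrt (ln n / n)) i j) \<le> prob ?B"
    by (intro finite_measure_mono sub sets.Un m)
  also have "\<dots> \<le> prob {s \<in> space P. n * t \<le> 1 * excess i j s} + prob {s \<in> space P. n * t \<le> -1 * excess i j s}"
    by (intro measure_Un_le m)
  also have "\<dots> \<le> 2 * exp (- (2 * n * t\<^sup>2))"
    using excess_tail[OF ij t, of 1] excess_tail[OF ij t, of "-1"] by simp
  \<comment> \<open>The exponent \<open>9 / 2\<close> is lowered to 3, which suffices for a union
    bound over at most \<open>n * n\<close> pairs.\<close>
  also have "\<dots> \<le> 2 * exp (- (3 * ln n))"
    unfolding t2 using ln_ge_1[OF n] by simp
  also have "\<dots> = 2 / n ^ 3"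
    using n exp_of_nat_mult[of 3 "ln (real n)"] by (simp add: exp_minus field_simps)
  finally show ?thesis .
qed

lemma prob_all_close:
  assumes n: "n \<ge> 3"
  shows "1 - 2 / n \<le> prob (space P - (\<Union>(i, j)\<in>{(i, j). i \<in> {1..n} \<and> j \<in> {1..n} \<and> i \<noteq> j}.
    deviation_event (3 * sqrt (ln n / n)) i j))" (is "_ \<le> prob (_ - ?U)")
proof -
  let ?I = "{(i, j). i \<in> {1..n} \<and> j \<in> {1..n} \<and> i \<noteq> j}"
  let ?D = "\<lambda>(i, j). deviation_event (3 * sqrt (ln n / n)) i j"
  have I: "?I \<subseteq> {1..n} \<times> {1..n}" by auto
  have fin: "finite ?I" by (rule finite_subset[OF I]) simp
  have meas: "?D ` ?I \<subseteq> events" using deviation_event_measurable by auto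
  have "prob ?U \<le> (\<Sum>p\<in>?I. prob (?D p))"
    by (rule finite_measure_subadditive_finite[OF fin meas])
  also have "\<dots> \<le> (\<Sum>p\<in>?I. 2 / n ^ 3)"
    using prob_deviation_event[OF _ _ _ n] by (intro sum_mono) auto
  also have "\<dots> \<le> (n * n) * (2 / n ^ 3)"
    using card_mono[OF _ I] by (simp only: sum_constant) (intro mult_right_mono, auto simp flip: of_nat_mult)
  also have "\<dots> = 2 / n" using n by (simp add: power3_eq_cube)
  finally show ?thesis
    using meas fin by (subst prob_compl) (auto intro!: sets.finite_UN)
qed

end

section \<open>Measurability of the error terms and of the comparison event\<close>

context graphon begin

lemma nbhd_dist_measurable:
  assumes X: "X \<in> N \<rightarrow>\<^sub>M M" and Y: "Y \<in> N \<rightarrow>\<^sub>M M"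
  shows "(\<lambda>x. nbhd_dist M W (X x) (Y x)) \<in> borel_measurable N"
proof -
  have ipm: "(\<lambda>x. nbhd_inner (X' x) (Y' x)) \<in> borel_measurable N" if "X' \<in> N \<rightarrow>\<^sub>M M" "Y' \<in> N \<rightarrow>\<^sub>M M" for X' Y'
    using measurable_compose[OF measurable_Pair[OF that] nbhd_inner_measurable] by simp
  have "nbhd_dist M W (X x) (Y x) = sqrt (nbhd_inner (X x) (X x) + nbhd_inner (Y x) (Y x) - 2 * nbhd_inner (X x) (Y x))"
    if "x \<in> space N" for x
    using nbhd_dist_sq[of "X x" "Y x"] nbhd_dist_nonneg[of "X x" "Y x"] that X Y
    by (metis measurable_space real_sqrt_abs abs_of_nonneg)
  moreover have "(\<lambda>x. sqrt (nbhd_inner (X x) (X x) + nbhd_inner (Y x) (Y x) - 2 * nbhd_inner (X x) (Y x))) \<in> borel_measurable N"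
    using ipm[OF X X] ipm[OF Y Y] ipm[OF X Y] by measurable
  ultimately show ?thesis by (rule iffD2[OF measurable_cong])
qed

end

section \<open>Reduction of \<open>s_sup\<close> to a countable supremum\<close>

context pure_graphon begin

context
  fixes n :: nat and w :: "nat \<Rightarrow> 'a"
  assumes n: "n > 0" and w: "\<And>i. i \<in> {1..n} \<Longrightarrow> w i \<in> space M"
begin

lemma INF_nbhd_attained: "\<exists>i\<in>{1..n}. nbhd_dist M W z (w i) = (INF i\<in>{1..n}. nbhd_dist M W z (w i))"
proof -
  have "(INF i\<in>{1..n}. nbhd_dist M W z (w i)) = Min ((\<lambda>i. nbhd_dist M W z (w i)) ` {1..n})"
    using n by (intro cInf_eq_Min) auto
  also have "\<dots> \<in> (\<lambda>i. nbhd_dist M W z (w i)) ` {1..n}"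
    using n by (intro Min_in) auto
  finally show ?thesis by fastforce
qed

lemma INF_nbhd_le: "i \<in> {1..n} \<Longrightarrow> (INF i\<in>{1..n}. nbhd_dist M W z (w i)) \<le> nbhd_dist M W z (w i)"
  by (intro cINF_lower bdd_below_finite) auto

lemma INF_nbhd_le_1: "z \<in> space M \<Longrightarrow> (INF i\<in>{1..n}. nbhd_dist M W z (w i)) \<le> 1"
  using INF_nbhd_le[of 1 z] nbhd_dist_le_1[of z "w 1"] w[of 1] n by force

text \<open>A real supremum is meaningful only for bounded sets; here all distances are at most
  1.\<close>

lemma bdd_above_INF_nbhd: "D \<subseteq> space M \<Longrightarrow> bdd_above ((\<lambda>z. INF i\<in>{1..n}. nbhd_dist M W z (w i)) ` D)"
  using INF_nbhd_le_1 by (intro bdd_aboveI[of _ 1]) auto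

lemma exists_near_latent:
  assumes "z \<in> space M"
  shows "\<exists>i\<in>{1..n}. nbhd_dist M W z (w i) \<le> s_sup n M W w"
  using INF_nbhd_attained[of z] cSUP_upper[OF assms bdd_above_INF_nbhd] unfolding s_sup_def by force

lemma INF_nbhd_lipschitz:
  assumes "x \<in> space M" "y \<in> space M"
  shows "(INF i\<in>{1..n}. nbhd_dist M W x (w i)) \<le> (INF i\<in>{1..n}. nbhd_dist M W y (w i)) + nbhd_dist M W x y"
proof -
  interpret Metric_space "space M" "nbhd_dist M W" by (rule metric)
  obtain i where i: "i \<in> {1..n}" "nbhd_dist M W y (w i) = (INF i\<in>{1..n}. nbhd_dist M W y (w i))"
    using INF_nbhd_attained by blast
  have "(INF i\<in>{1..n}. nbhd_dist M W x (w i)) \<le> nbhd_dist M W x (w i)"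
    by (rule INF_nbhd_le[OF i(1)])
  also have "\<dots> \<le> nbhd_dist M W x y + nbhd_dist M W y (w i)"
    using assms w[OF i(1)] by (rule triangle)
  finally show ?thesis using i by simp
qed

text \<open>The distance to the finite set of nodes is 1-Lipschitz, so its supremum can be taken
  over a dense subset.\<close>

lemma s_sup_dense:
  assumes D: "D \<subseteq> space M" and dense: "\<And>x r. x \<in> space M \<Longrightarrow> r > 0 \<Longrightarrow> \<exists>y\<in>D. nbhd_dist M W x y < r"
  shows "s_sup n M W w = (SUP z\<in>D. INF i\<in>{1..n}. nbhd_dist M W z (w i))"
  unfolding s_sup_def
proof (rule antisym)
  show "(SUP z\<in>space M. INF i\<in>{1..n}. nbhd_dist M W z (w i)) \<le> (SUP z\<in>D. INF i\<in>{1..n}. nbhd_dist M W z (w i))"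
  proof (rule cSUP_least[OF not_empty], rule field_le_epsilon)
    fix z and e :: real assume z: "z \<in> space M" and e: "e > 0"
    then obtain y where y: "y \<in> D" "nbhd_dist M W z y < e" using dense by blast
    have "(INF i\<in>{1..n}. nbhd_dist M W y (w i)) \<le> (SUP z\<in>D. INF i\<in>{1..n}. nbhd_dist M W z (w i))"
      using y D by (intro cSUP_upper bdd_above_INF_nbhd)
    then show "(INF i\<in>{1..n}. nbhd_dist M W z (w i)) \<le> (SUP z\<in>D. INF i\<in>{1..n}. nbhd_dist M W z (w i)) + e"
      using INF_nbhd_lipschitz[of z y] y z D by auto
  qed
  have "D \<noteq> {}" using dense not_empty zero_less_one by blast
  then show "(SUP z\<in>D. INF i\<in>{1..n}. nbhd_dist M W z (w i)) \<le> (SUP z\<in>space M. INF i\<in>{1..n}. nbhd_dist M W z (w i))"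
    using D by (intro cSUP_subset_mono bdd_above_INF_nbhd) auto
qed

end

text \<open>Separability provides a countable dense set, and a countable supremum of measurable
  functions is measurable.\<close>

lemma s_sup_measurable:
  assumes n: "n > 0" and X: "\<And>i. i \<in> {1..n} \<Longrightarrow> (\<lambda>x. X x i) \<in> N \<rightarrow>\<^sub>M M"
  shows "(\<lambda>x. s_sup n M W (X x)) \<in> borel_measurable N"
proof -
  interpret Metric_space "space M" "nbhd_dist M W" by (rule metric)
  obtain D where D: "countable D" "D \<subseteq> space M" "mtopology closure_of D = space M"
    using separable by (auto simp: separable_space_def)
  have dense: "\<exists>y\<in>D. nbhd_dist M W x y < r" if "x \<in> space M" "r > 0" for x r
    using D(3) that by (auto simp: metric_closure_of)
  have Xs: "X x i \<in> space M" if "x \<in> space N" "i \<in> {1..n}" for x i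
    using measurable_space[OF X] that by blast
  have "s_sup n M W (X x) = (SUP z\<in>D. INF i\<in>{1..n}. nbhd_dist M W z (X x i))" if "x \<in> space N" for x
    using s_sup_dense[OF n _ D(2) dense, of "X x"] Xs that by blast
  moreover have "(\<lambda>x. SUP z\<in>D. INF i\<in>{1..n}. nbhd_dist M W z (X x i)) \<in> borel_measurable N"
  proof (rule borel_measurable_cSUP[OF D(1)])
    fix z assume "z \<in> D"
    then show "(\<lambda>x. INF i\<in>{1..n}. nbhd_dist M W z (X x i)) \<in> borel_measurable N"
      using X D by (intro borel_measurable_cINF_real nbhd_dist_measurable measurable_const) auto
  next
    fix x assume "x \<in> space N"
    then show "bdd_above ((\<lambda>z. INF i\<in>{1..n}. nbhd_dist M W z (X x i)) ` D)"
      using bdd_above_INF_nbhd[OF n _ D(2), of "X x"] Xs by simp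
  qed
  ultimately show ?thesis by (rule iffD2[OF measurable_cong])
qed

end

section \<open>The comparison of covering numbers as an event\<close>

lemma row_inner_cong:
  assumes "\<And>l. l \<in> {1..n} \<Longrightarrow> u l = u' l" "\<And>l. l \<in> {1..n} \<Longrightarrow> v l = v' l"
  shows "row_inner n u v = row_inner n u' v'"
  unfolding row_inner_def using assms by (intro arg_cong2[where f="(*)"] refl sum.cong) auto

text \<open>The two error terms are merged into one real \<open>c\<close>, and all tie-breaking maps
  \<open>mhat\<close> are quantified inside. What remains depends on a matrix and one real
  number.\<close>

definition covering_comparison ::
    "nat \<Rightarrow> 'a measure \<Rightarrow> ('a \<Rightarrow> 'a \<Rightarrow> real) \<Rightarrow> (nat \<Rightarrow> nat \<Rightarrow> real) \<Rightarrow> real \<Rightarrow> bool" where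
  "covering_comparison n M W a c \<longleftrightarrow> (\<forall>mhat. other_argmin n (f_hat n a) mhat \<longrightarrow> (\<forall>\<epsilon> > c.
     covering_number (space M) (nbhd_dist M W) (\<epsilon> + c) \<le> covering_number {1..n} (r_hat n a mhat) \<epsilon> \<and>
     covering_number {1..n} (r_hat n a mhat) \<epsilon> \<le> covering_number (space M) (nbhd_dist M W) (\<epsilon> - c)))"

text \<open>A larger \<open>c\<close> leaves fewer \<epsilon> to check and weakens both
  inequalities, since covering numbers decrease in the radius.\<close>

lemma covering_comparison_mono:
  assumes "c \<le> c'" "covering_comparison n M W a c"
  shows "covering_comparison n M W a c'"
  unfolding covering_comparison_def
proof (intro allI impI conjI)
  fix mhat \<epsilon> assume *: "other_argmin n (f_hat n a) mhat" "c' < \<epsilon>"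
  then have 1: "covering_number (space M) (nbhd_dist M W) (\<epsilon> + c) \<le> covering_number {1..n} (r_hat n a mhat) \<epsilon>"
    and 2: "covering_number {1..n} (r_hat n a mhat) \<epsilon> \<le> covering_number (space M) (nbhd_dist M W) (\<epsilon> - c)"
    using assms by (auto simp: covering_comparison_def)
  show "covering_number (space M) (nbhd_dist M W) (\<epsilon> + c') \<le> covering_number {1..n} (r_hat n a mhat) \<epsilon>"
    by (rule order_trans[OF covering_number_antimono 1]) (use assms in simp)
  show "covering_number {1..n} (r_hat n a mhat) \<epsilon> \<le> covering_number (space M) (nbhd_dist M W) (\<epsilon> - c')"
    by (rule order_trans[OF 2 covering_number_antimono]) (use assms in simp)
qed

text \<open>Entries of \<open>A s\<close> outside the node range are arbitrary; ignoring them leaves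
  finitely many matrices to distinguish.\<close>

lemma covering_comparison_cong:
  assumes "\<And>i j. i \<in> {1..n} \<Longrightarrow> j \<in> {1..n} \<Longrightarrow> a i j = a' i j"
  shows "covering_comparison n M W a c = covering_comparison n M W a' c"
proof -
  have *: "covering_comparison n M W b' c" if "covering_comparison n M W b c"
    and b: "\<And>i j. i \<in> {1..n} \<Longrightarrow> j \<in> {1..n} \<Longrightarrow> b i j = b' i j" for b b'
    unfolding covering_comparison_def
  proof (intro allI impI)
    fix mhat \<epsilon> assume m: "other_argmin n (f_hat n b') mhat" and \<epsilon>: "c < \<epsilon>"
    have f: "f_hat n b i j = f_hat n b' i j" if "i \<in> {1..n}" "j \<in> {1..n}" for i j
      unfolding f_hat_def using that b
      by (intro arg_cong[where f=Max] image_cong refl arg_cong[where f=abs] row_inner_cong) auto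
    have m': "other_argmin n (f_hat n b) mhat"
      unfolding other_argmin_def is_arg_min_def
    proof (intro ballI)
      fix i assume i: "i \<in> {1..n}"
      note mi = other_argminD[OF m i]
      show "(mhat i \<in> {1..n} \<and> mhat i \<noteq> i) \<and>
          \<not> (\<exists>y. (y \<in> {1..n} \<and> y \<noteq> i) \<and> f_hat n b i y < f_hat n b i (mhat i))"
        using mi(1,2) mi(3) f[OF i] f[OF i mi(1)] by (metis linorder_not_le)
    qed
    have r: "r_hat n b mhat i j = r_hat n b' mhat i j" if "i \<in> {1..n}" "j \<in> {1..n}" for i j
    proof -
      have "row_inner n (b k) (b l) = row_inner n (b' k) (b' l)" if "k \<in> {1..n}" "l \<in> {1..n}" for k l
        using that b by (intro row_inner_cong) auto
      then show ?thesis
        using that other_argminD(1)[OF m] by (simp add: r_hat_def r_hat_sq_def)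
    qed
    have "covering_number {1..n} (r_hat n b mhat) \<epsilon> = covering_number {1..n} (r_hat n b' mhat) \<epsilon>"
      by (rule covering_number_cong) (rule r)
    moreover have "covering_number (space M) (nbhd_dist M W) (\<epsilon> + c) \<le> covering_number {1..n} (r_hat n b mhat) \<epsilon> \<and>
        covering_number {1..n} (r_hat n b mhat) \<epsilon> \<le> covering_number (space M) (nbhd_dist M W) (\<epsilon> - c)"
      using that(1) m' \<epsilon> unfolding covering_comparison_def by blast
    ultimately show "covering_number (space M) (nbhd_dist M W) (\<epsilon> + c) \<le> covering_number {1..n} (r_hat n b' mhat) \<epsilon> \<and>
        covering_number {1..n} (r_hat n b' mhat) \<epsilon> \<le> covering_number (space M) (nbhd_dist M W) (\<epsilon> - c)"
      by simp
  qed
  show ?thesis using *[of a a'] *[of a' a] assms by metis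
qed

context sampled_graphon begin

text \<open>The quantifier over \<open>\<epsilon>\<close> is uncountable; measurability holds because the set of admissible \<open>c\<close> is an
  up-set of reals for each of the finitely many adjacency matrices.\<close>

lemma covering_comparison_event:
  assumes c: "c \<in> borel_measurable P"
  shows "{s \<in> space P. covering_comparison n M W (A s) (c s)} \<in> events"
proof -
  let ?N = "{1..n} \<times> {1..n}"
  define a where "a S i j = (of_bool ((i, j) \<in> S) :: real)" for S :: "(nat \<times> nat) set" and i j
  \<comment> \<open>The event is split according to the adjacency matrix, encoded as the set
    \<open>S\<close> of its entries equal to 1.\<close>
  have "{s \<in> space P. covering_comparison n M W (A s) (c s)} =
      (\<Union>S\<in>Pow ?N. {s \<in> space P. \<forall>p\<in>?N. A s (fst p) (snd p) = a S (fst p) (snd p)} \<inter>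
        {s \<in> space P. covering_comparison n M W (a S) (c s)})" (is "?L = ?R")
  proof (intro equalityI subsetI)
    fix s assume s: "s \<in> ?L"
    define S where "S = {p \<in> ?N. A s (fst p) (snd p) = 1}"
    have AS: "A s i j = a S i j" if "i \<in> {1..n}" "j \<in> {1..n}" for i j
      using A_01[of s i j] that s by (auto simp: a_def S_def)
    then have "covering_comparison n M W (a S) (c s)"
      using covering_comparison_cong[of n "A s" "a S"] s by blast
    then show "s \<in> ?R" using AS s by (intro UN_I[of S]) (auto simp: S_def)
  next
    fix s assume "s \<in> ?R"
    then obtain S where S: "s \<in> space P" "\<And>i j. i \<in> {1..n} \<Longrightarrow> j \<in> {1..n} \<Longrightarrow> A s i j = a S i j"
      "covering_comparison n M W (a S) (c s)" by force
    then show "s \<in> ?L" using covering_comparison_cong[of n "A s" "a S"] by blast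
  qed
  also have "\<dots> \<in> events"
  proof (intro sets.finite_UN sets.Int)
    show "finite (Pow ?N)" by simp
    fix S assume "S \<in> Pow ?N"
    show "{s \<in> space P. \<forall>p\<in>?N. A s (fst p) (snd p) = a S (fst p) (snd p)} \<in> events"
    proof (rule sets.sets_Collect_finite_All)
      fix p assume p: "p \<in> ?N"
      then have "(\<lambda>s. A s (fst p) (snd p)) \<in> borel_measurable P" by (intro A_measurable) auto
      from measurable_sets[OF this, of "{a S (fst p) (snd p)}"]
      show "{s \<in> space P. A s (fst p) (snd p) = a S (fst p) (snd p)} \<in> events"
        by (simp add: vimage_def Int_def conj_commute)
    qed simp
    \<comment> \<open>The indicator of an up-set is monotone, hence Borel.\<close>
    define q where "q b = (of_bool (covering_comparison n M W (a S) b) :: real)" for b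
    have "mono q" using covering_comparison_mono by (fastforce simp: mono_def q_def)
    then have "(\<lambda>s. q (c s)) \<in> borel_measurable P"
      using c borel_measurable_mono measurable_compose by blast
    from measurable_sets[OF this, of "{1}"]
    show "{s \<in> space P. covering_comparison n M W (a S) (c s)} \<in> events"
      by (simp add: vimage_def Int_def conj_commute q_def)
  qed
  finally show ?thesis .
qed

end

text \<open>The value of \<open>b_sup\<close> at a nearest-neighbour map, written without reference to the map; this makes
  it a random variable.\<close>

definition max_min_dist :: "nat \<Rightarrow> (nat \<Rightarrow> nat \<Rightarrow> real) \<Rightarrow> real" where
  "max_min_dist n g = Max ((\<lambda>i. Min (g i ` ({1..n} - {i}))) ` {1..n})"

lemma other_argmin_Min:
  assumes m: "other_argmin n g m" "i \<in> {1..n}"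
  shows "g i (m i) = Min (g i ` ({1..n} - {i}))"
  using other_argminD(1,2)[OF m] by (intro Min_eqI[symmetric]) (auto intro: other_argminD(3)[OF m])

lemma other_argmin_exists:
  assumes "n \<ge> 2"
  shows "\<exists>m. other_argmin n g m"
proof -
  have "\<exists>j. is_arg_min (g i) (\<lambda>j. j \<in> {1..n} \<and> j \<noteq> i) j" for i
  proof -
    have "{j. j \<in> {1..n} \<and> j \<noteq> i} \<noteq> {}"
      using assms by (cases "i = 1") (auto intro: exI[of _ 1] exI[of _ 2])
    then show ?thesis
      using ex_is_arg_min_if_finite[of "{j. j \<in> {1..n} \<and> j \<noteq> i}" "g i"] by auto
  qed
  then show ?thesis unfolding other_argmin_def by metis
qed

text \<open>All nearest-neighbour maps attain the same minimal distances, so the way ties are broken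
  does not affect \<open>b_sup\<close>.\<close>

lemma b_sup_eq:
  assumes "n > 0" "other_argmin n (\<lambda>i t. nbhd_dist M W (w i) (w t)) m"
  shows "b_sup n M W w m =
    sqrt (6 * max_min_dist n (\<lambda>i t. nbhd_dist M W (w i) (w t)) + 36 * sqrt (ln (real n) / real n))"
proof -
  have "(SUP i\<in>{1..n}. nbhd_dist M W (w i) (w (m i))) =
      (SUP i\<in>{1..n}. Min ((\<lambda>t. nbhd_dist M W (w i) (w t)) ` ({1..n} - {i})))"
    using other_argmin_Min[OF assms(2)] by (intro SUP_cong) auto
  also have "\<dots> = max_min_dist n (\<lambda>i t. nbhd_dist M W (w i) (w t))"
    unfolding max_min_dist_def using assms(1) by (intro cSup_eq_Max) auto
  finally show ?thesis by (simp add: b_sup_def)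
qed

theorem proposition11:
  fixes n :: nat and M :: "'a measure" and W :: "'a \<Rightarrow> 'a \<Rightarrow> real"
    and P :: "'s measure" and \<omega> :: "'s \<Rightarrow> nat \<Rightarrow> 'a" and A :: "'s \<Rightarrow> nat \<Rightarrow> nat \<Rightarrow> real"
  assumes "n \<ge> 3"
    and "pure_graphon M W"
    and "W_random_graph P n M W \<omega> A"
  shows "\<P>(x in P. \<forall>m mhat.
      other_argmin n (\<lambda>i t. nbhd_dist M W (\<omega> x i) (\<omega> x t)) m \<longrightarrow>
      other_argmin n (f_hat n (A x)) mhat \<longrightarrow>
      (\<forall>\<epsilon> > b_sup n M W (\<omega> x) m + s_sup n M W (\<omega> x).
         covering_number (space M) (nbhd_dist M W)
             (\<epsilon> + b_sup n M W (\<omega> x) m + s_sup n M W (\<omega> x))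
           \<le> covering_number {1..n} (r_hat n (A x) mhat) \<epsilon> \<and>
         covering_number {1..n} (r_hat n (A x) mhat) \<epsilon>
           \<le> covering_number (space M) (nbhd_dist M W)
                (\<epsilon> - b_sup n M W (\<omega> x) m - s_sup n M W (\<omega> x))))
    \<ge> 1 - 2 / real n"
proof -
  interpret G: pure_graphon M W by fact
  interpret W_random_graph P n M W \<omega> A by fact
  interpret sampled_graphon P n M W \<omega> A ..
  note n = \<open>n \<ge> 3\<close>
  define b where "b s = sqrt (6 * max_min_dist n (\<lambda>i t. nbhd_dist M W (\<omega> s i) (\<omega> s t)) +
    36 * sqrt (ln (real n) / real n))" for s
  define c where "c s = b s + s_sup n M W (\<omega> s)" for s
  have b_sup: "b_sup n M W (\<omega> s) m = b s"
    if "other_argmin n (\<lambda>i t. nbhd_dist M W (\<omega> s i) (\<omega> s t)) m" for s m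
    unfolding b_def using n that by (intro b_sup_eq) auto
  have "(\<forall>m mhat. other_argmin n (\<lambda>i t. nbhd_dist M W (\<omega> x i) (\<omega> x t)) m \<longrightarrow>
      other_argmin n (f_hat n (A x)) mhat \<longrightarrow>
      (\<forall>\<epsilon> > b_sup n M W (\<omega> x) m + s_sup n M W (\<omega> x).
         covering_number (space M) (nbhd_dist M W) (\<epsilon> + b_sup n M W (\<omega> x) m + s_sup n M W (\<omega> x))
           \<le> covering_number {1..n} (r_hat n (A x) mhat) \<epsilon> \<and>
         covering_number {1..n} (r_hat n (A x) mhat) \<epsilon>
           \<le> covering_number (space M) (nbhd_dist M W) (\<epsilon> - b_sup n M W (\<omega> x) m - s_sup n M W (\<omega> x)))) \<longleftrightarrow>
    covering_comparison n M W (A x) (c x)" (is "?E x \<longleftrightarrow> _") for x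
  proof -
    obtain m where m: "other_argmin n (\<lambda>i t. nbhd_dist M W (\<omega> x i) (\<omega> x t)) m"
      using other_argmin_exists[of n] n by auto
    show ?thesis
      unfolding covering_comparison_def c_def add.assoc[symmetric] diff_diff_eq[symmetric]
      using m b_sup[of x] by auto
  qed
  then have E: "{x \<in> space P. ?E x} = {x \<in> space P. covering_comparison n M W (A x) (c x)}" by blast
  \<comment> \<open>Needed for the event to be measurable: monotonicity of \<open>prob\<close>
    requires the larger set to be an event.\<close>
  have c_meas: "c \<in> borel_measurable P"
  proof -
    have "(\<lambda>s. nbhd_dist M W (\<omega> s i) (\<omega> s t)) \<in> borel_measurable P" if "i \<in> {1..n}" "t \<in> {1..n}" for i t
      using that by (intro G.nbhd_dist_measurable latent_coord_measurable)
    then have "(\<lambda>s. max_min_dist n (\<lambda>i t. nbhd_dist M W (\<omega> s i) (\<omega> s t))) \<in> borel_measurable P"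
      unfolding max_min_dist_def by (intro borel_measurable_Max borel_measurable_Min) auto
    moreover have "(\<lambda>s. s_sup n M W (\<omega> s)) \<in> borel_measurable P"
      using n by (intro G.s_sup_measurable latent_coord_measurable) auto
    ultimately show ?thesis unfolding c_def[abs_def] b_def by measurable
  qed
  let ?U = "\<Union>(i, j)\<in>{(i, j). i \<in> {1..n} \<and> j \<in> {1..n} \<and> i \<noteq> j}.
    deviation_event (3 * sqrt (ln n / n)) i j"
  have "covering_comparison n M W (A s) (c s)" if s: "s \<in> space P" and sU: "s \<notin> ?U" for s
    unfolding covering_comparison_def
  proof (intro allI impI)
    fix mhat \<epsilon> assume mhat: "other_argmin n (f_hat n (A s)) mhat" and "c s < \<epsilon>"
    obtain m where m: "other_argmin n (\<lambda>i t. nbhd_dist M W (\<omega> s i) (\<omega> s t)) m"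
      using other_argmin_exists[of n] n by auto
    let ?R = "max_min_dist n (\<lambda>i t. nbhd_dist M W (\<omega> s i) (\<omega> s t))"
    have w: "\<omega> s i \<in> space M" if "i \<in> {1..n}" for i
      using latent_in_space[OF s that] .
    have close: "\<bar>row_inner n (A s i) (A s j) - G.nbhd_inner (\<omega> s i) (\<omega> s j)\<bar> \<le> 3 * sqrt (ln n / n)"
      if "i \<in> {1..n}" "j \<in> {1..n}" "i \<noteq> j" for i j
    proof -
      have "s \<notin> deviation_event (3 * sqrt (ln n / n)) i j" using sU that by blast
      then show ?thesis using s by (simp add: deviation_event_def)
    qed
    have nearest: "m i \<in> {1..n} \<and> m i \<noteq> i \<and> nbhd_dist M W (\<omega> s i) (\<omega> s (m i)) \<le> ?R"
      if "i \<in> {1..n}" for i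
      using other_argminD(1,2)[OF m that] that unfolding other_argmin_Min[OF m that] max_min_dist_def
      by (auto intro!: Max_ge)
    have "\<bar>r_hat n (A s) mhat i j - nbhd_dist M W (\<omega> s i) (\<omega> s j)\<bar> \<le> b s"
      if "i \<in> {1..n}" "j \<in> {1..n}" for i j
      \<comment> \<open>With \<open>\<delta> = 3 * sqrt (ln n / n)\<close> the term
        \<open>12 * \<delta>\<close> is the \<open>36 * sqrt (ln n / n)\<close> of
        \<open>b_sup\<close>.\<close>
      using G.r_hat_close[OF n w A_01[OF s] close nearest mhat that] by (simp add: b_def)
    moreover have "\<exists>i\<in>{1..n}. nbhd_dist M W z (\<omega> s i) \<le> s_sup n M W (\<omega> s)" if "z \<in> space M" for z
      using G.exists_near_latent[OF _ w that] n by simp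
    ultimately show "covering_number (space M) (nbhd_dist M W) (\<epsilon> + c s) \<le> covering_number {1..n} (r_hat n (A s) mhat) \<epsilon> \<and>
        covering_number {1..n} (r_hat n (A s) mhat) \<epsilon> \<le> covering_number (space M) (nbhd_dist M W) (\<epsilon> - c s)"
      using Metric_space.covering_number_approx[OF G.metric, of "\<omega> s" "{1..n}"] w
      unfolding c_def add.assoc[symmetric] diff_diff_eq[symmetric] by blast
  qed
  then have "space P - ?U \<subseteq> {x \<in> space P. ?E x}" unfolding E by blast
  then have "prob (space P - ?U) \<le> prob {x \<in> space P. ?E x}"
    using covering_comparison_event[OF c_meas] unfolding E by (intro finite_measure_mono)
  then show ?thesis using prob_all_close[OF n] by linarith
qed

end
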